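(* Let $M\in M_{n,n}(K)$ be a matrix which does not have two Jordan blocks with the same generalized eigenvalue. Then the precision polygon $\mathrm{PP}(M)$ lies between $T_1(\mathrm{HP}(M))$ and $\mathrm{NP}(M)$. Moreover, $\mathrm{PP}(M)$ and $T_1(\mathrm{HP}(M))$ meet at the abscissas $0$ and $n-1$.
   Context: $K$ is a complete discrete valuation field with surjective valuation $\mathrm{val} : K \to \mathbb{Z}\cup\{+\infty\}$ and ring of integers $\mathcal{O}_K$. Smith decomposition: a matrix $M\in M_{n,n}(K)$ can be written $M = U_M\cdot\Delta_M\cdot V_M$ with $U_M, V_M$ unimodular (i.e. in $GL_n(\mathcal{O}_K)$) and $\Delta_M$ diagonal. $\sigma_i(M)$ denotes the valuation of the $(i,i)$-th entry of $\Delta_M$, ordered so that $\sigma_i(M)\le\sigma_{i+1}(M)$. The Newton polygon $\mathrm{NP}(f)$ of a polynomial $f(X)=\sum_i a_iX^i \in K[X]$ is the lower convex hull of the points $(i,\mathrm{val}(a_i))$, and $\mathrm{NP}(M)$ is the Newton polygon of the characteristic polynomial of $M$. The Hodge polygon $\mathrm{HP}(M)$ is the lower convex hull of the points $(i,\sum_{j=1}^{n-i}\sigma_j(M))$, $0\le i\le n$. $\mathrm{Com}(X-M)$ is the comatrix of $X-M$, so that $(X-M)\cdot\mathrm{Com}(X-M)=\det(X-M)\cdot I$; its entries are polynomials of degree $<n$. The precision polygon $\mathrm{PP}(M)$ is the lower convex hull of the Newton polygons of the entries of $\mathrm{Com}(X-M)$. If a polygon $P$ has vertices $(x_i,y_i)$,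 then $T_m(P)$ denotes the translated polygon with vertices $(x_i-m,y_i)$.
   Formalization: PP(M) ≤ NP(M) is claimed only when the characteristic polynomial of M has coefficients in O_K (it fails otherwise, e.g. n=1, M=(1/π)); for general M the upper bound is T_1(NP(M)). The lower bound and both meeting points are for all M. *)

theory Defs
  imports
    "HOL-Analysis.Convex"
    "HOL-Library.Extended_Real"
    "HOL-Algebra.Algebraic_Closure_Type"
    "Jordan_Normal_Form.Char_Poly"
    "Jordan_Normal_Form.Jordan_Normal_Form"
begin

text \<open>The value group is embedded in \<^typ>\<open>ereal\<close>, so that polygons can be
  taken over the real numbers.\<close>

locale complete_dvf =
  fixes val :: "'a :: field \<Rightarrow> ereal"
  assumes val_eq_infinity_iff: "val x = \<infinity> \<longleftrightarrow> x = 0"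
    and val_mult: "val (x * y) = val x + val y"
    and val_add: "min (val x) (val y) \<le> val (x + y)"
    and range_val: "range val = insert \<infinity> (range (\<lambda>k :: int. ereal (real_of_int k)))"
    and val_complete:
      "\<And>s :: nat \<Rightarrow> 'a. (\<And>N :: nat. \<exists>k. \<forall>i\<ge>k. \<forall>j\<ge>k. ereal (real N) \<le> val (s i - s j)) \<Longrightarrow>
        \<exists>l. \<forall>N :: nat. \<exists>k. \<forall>i\<ge>k. ereal (real N) \<le> val (s i - l)"

definition integers_of :: "('a :: field \<Rightarrow> ereal) \<Rightarrow> 'a set" where
  "integers_of val = {x. 0 \<le> val x}"

definition unimodular :: "('a :: field \<Rightarrow> ereal) \<Rightarrow> nat \<Rightarrow> 'a mat \<Rightarrow> bool" where
  "unimodular val n U \<longleftrightarrow> U \<in> carrier_mat n n \<and> elements_mat U \<subseteq> integers_of val \<and>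
     (\<exists>W \<in> carrier_mat n n. elements_mat W \<subseteq> integers_of val \<and> inverts_mat U W \<and> inverts_mat W U)"

definition smith_decomposition ::
  "('a :: field \<Rightarrow> ereal) \<Rightarrow> 'a mat \<Rightarrow> 'a mat \<Rightarrow> 'a mat \<Rightarrow> 'a mat \<Rightarrow> bool" where
  "smith_decomposition val M U D V \<longleftrightarrow> (let n = dim_row M in
     unimodular val n U \<and> unimodular val n V \<and> D \<in> carrier_mat n n \<and> diagonal_mat D \<and>
     (\<forall>i j. i \<le> j \<and> j < n \<longrightarrow> val (D $$ (i, i)) \<le> val (D $$ (j, j))) \<and>
     M = U * D * V)"

text \<open>The valuations of the ordered diagonal entries do not depend on the chosen
  decomposition. The index \<open>i\<close> starts at 1, while matrix indices start at 0.\<close>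

definition smith_diagonal :: "('a :: field \<Rightarrow> ereal) \<Rightarrow> 'a mat \<Rightarrow> 'a mat" where
  "smith_diagonal val M = (SOME D. \<exists>U V. smith_decomposition val M U D V)"

definition sigma :: "('a :: field \<Rightarrow> ereal) \<Rightarrow> 'a mat \<Rightarrow> nat \<Rightarrow> ereal" where
  "sigma val M i = val (smith_diagonal val M $$ (i - 1, i - 1))"

text \<open>A polygon is represented by its height function, with value \<open>\<infinity>\<close> at the
  abscissas it does not cover. Points of height \<open>\<infinity>\<close> do not contribute to a hull.\<close>

type_synonym polygon = "real \<Rightarrow> ereal"

definition graph_points :: "polygon \<Rightarrow> (real \<times> real) set" where
  "graph_points P = {(x, y). P x = ereal y}"

definition lower_convex_hull :: "(real \<times> real) set \<Rightarrow> polygon" where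
  "lower_convex_hull S x = (INF y \<in> {y. (x, y) \<in> convex hull S}. ereal y)"

definition translate_polygon :: "real \<Rightarrow> polygon \<Rightarrow> polygon" where
  "translate_polygon m P x = P (x + m)"

definition newton_polygon :: "('a :: field \<Rightarrow> ereal) \<Rightarrow> 'a poly \<Rightarrow> polygon" where
  "newton_polygon val f = lower_convex_hull {(real i, y) |i y. val (coeff f i) = ereal y}"

definition NP :: "('a :: field \<Rightarrow> ereal) \<Rightarrow> 'a mat \<Rightarrow> polygon" where
  "NP val M = newton_polygon val (char_poly M)"

definition HP :: "('a :: field \<Rightarrow> ereal) \<Rightarrow> 'a mat \<Rightarrow> polygon" where
  "HP val M = (let n = dim_row M in
     lower_convex_hull {(real i, y) |i y. i \<le> n \<and> (\<Sum>j = 1..n - i. sigma val M j) = ereal y})"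

text \<open>The comatrix of \<open>X - M\<close>, with the convention
  \<open>(X - M) * Com M = det (X - M) * I\<close>.\<close>

definition Com :: "'a :: field mat \<Rightarrow> 'a poly mat" where
  "Com M = adj_mat (char_poly_matrix M)"

definition PP :: "('a :: field \<Rightarrow> ereal) \<Rightarrow> 'a mat \<Rightarrow> polygon" where
  "PP val M = lower_convex_hull (\<Union>f \<in> elements_mat (Com M). graph_points (newton_polygon val f))"

definition meet_at :: "polygon \<Rightarrow> polygon \<Rightarrow> real \<Rightarrow> bool" where
  "meet_at P Q x \<longleftrightarrow> (\<exists>y :: real. P x = ereal y \<and> Q x = ereal y)"

text \<open>The generalized eigenvalues of \<open>M\<close> live in an algebraic closure of the base field.\<close>

definition distinct_jordan_eigenvalues :: "'a :: field mat \<Rightarrow> bool" where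
  "distinct_jordan_eigenvalues M \<longleftrightarrow>
     (\<exists>n_as. jordan_nf (map_mat to_ac M) n_as \<and> distinct (map snd n_as))"

end

theory Submission
  imports
    Defs
    "HOL-Analysis.Starlike"
    "Jordan_Normal_Form.Column_Operations"
    "Jordan_Normal_Form.Jordan_Normal_Form_Uniqueness"
begin

text \<open>With a Smith decomposition \<open>M = U D V\<close> one has \<open>X - M = U (X W - D) V\<close> for an integral \<open>W\<close>, so up to
  integral constant factors on both sides the comatrix of \<open>X - M\<close> is that of \<open>X W - D\<close>. Expanding its
  minors bounds the coefficients of \<open>Com (X - M)\<close> by partial sums of the \<open>\<sigma>\<^sub>i\<close>, which gives the Hodge
  bound; at \<open>X = 0\<close> the last minor of \<open>D\<close> attains it, and it is finite since distinct Jordan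
  eigenvalues leave at most one zero on the diagonal of \<open>D\<close>.

  For the Newton bound, the coefficients satisfy \<open>M C\<^sub>k = C\<^sub>k\<^sub>-\<^sub>1 - a\<^sub>k\<close>. A supporting line of the
  precision polygon bounds all \<open>C\<^sub>k\<close>, and if some \<open>a\<^sub>k\<close> were too small, \<open>C\<^sub>k\<close> would be an approximate
  inverse of \<open>M\<close>, forcing the Newton polygon to have its extreme point at \<open>0\<close> instead.\<close>

no_notation fps_nth (infixl \<open>$\<close> 75)

section \<open>Lower convex hulls\<close>

text \<open>The shift by one has the same source on both sides: entries of the comatrix are minors
  of size \<open>n - 1\<close>, so their coefficient of index \<open>k\<close> collects
  \<open>n - 1 - k\<close> of the \<open>\<sigma>\<^sub>i\<close>, and in the recursion
  \<open>a\<^sub>k\<close> stands next to \<open>C\<^sub>k\<^sub>-\<^sub>1\<close>. The obstacle to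
  the Newton bound is that \<open>M\<close> need not be integral: a bound on
  \<open>C\<^sub>k\<close> says nothing about \<open>M C\<^sub>k\<close>, so
  \<open>a\<^sub>k\<close> cannot be estimated directly from the recursion. What a bound on a matrix
  \<open>N\<close> with \<open>M N\<close> close to a scalar does control is every coefficient of
  the characteristic polynomial relative to the constant one, because the determinant of
  \<open>(X - M) N\<close> can be estimated from its entries and also factors. Polygons are compared
  through lines: a hull is at most \<open>y\<close> at a covered abscissa as soon as every
  nonvertical line below its generators is. This turns a statement about all real abscissas into
  inequalities between valuations of coefficients.\<close>

definition up_closure :: "(real \<times> real) set \<Rightarrow> (real \<times> real) set" where
  "up_closure A = {(x, y). \<exists>y' \<le> y. (x, y') \<in> A}"

lemma convex_up_closure:
  assumes "convex A"
  shows "convex (up_closure A)"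
proof (rule convexI)
  fix p q :: "real \<times> real" and s t :: real
  assume "p \<in> up_closure A" "q \<in> up_closure A" and st: "0 \<le> s" "0 \<le> t" "s + t = 1"
  then obtain px py py' qx qy qy' where p: "p = (px, py)" "py' \<le> py" "(px, py') \<in> A"
    and q: "q = (qx, qy)" "qy' \<le> qy" "(qx, qy') \<in> A"
    unfolding up_closure_def by auto
  have "s *\<^sub>R (px, py') + t *\<^sub>R (qx, qy') \<in> A"
    using assms p(3) q(3) st by (rule convexD)
  moreover have "s * py' + t * qy' \<le> s * py + t * qy"
    using p(2) q(2) st by (intro add_mono mult_left_mono)
  ultimately show "s *\<^sub>R p + t *\<^sub>R q \<in> up_closure A"
    unfolding up_closure_def p(1) q(1) by auto
qed

lemma lower_convex_hull_le: "(x, y) \<in> up_closure (convex hull S) \<Longrightarrow> lower_convex_hull S x \<le> ereal y"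
  unfolding up_closure_def lower_convex_hull_def by (auto intro: INF_lower2)

lemma lower_convex_hull_point_le: "(x, y) \<in> S \<Longrightarrow> lower_convex_hull S x \<le> ereal y"
  by (rule lower_convex_hull_le) (auto simp: up_closure_def intro: hull_inc)

lemma lower_convex_hull_geI:
  "(\<And>y. (x, y) \<in> convex hull S \<Longrightarrow> e \<le> ereal y) \<Longrightarrow> e \<le> lower_convex_hull S x"
  unfolding lower_convex_hull_def by (auto intro: INF_greatest)

text \<open>Points above the hull of \<open>S\<close> cannot lower it, and the up-closure of a
  convex set is convex, so checking the generators of \<open>T\<close> is enough. The up-closure
  lets the generators be compared by height instead of by membership in the hull.\<close>

lemma lower_convex_hull_mono:
  assumes "T \<subseteq> up_closure (convex hull S)"
  shows "lower_convex_hull S x \<le> lower_convex_hull T x"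
proof (rule lower_convex_hull_geI)
  fix y assume "(x, y) \<in> convex hull T"
  moreover have "convex hull T \<subseteq> up_closure (convex hull S)"
    by (rule hull_minimal[where S = convex, OF assms]) (simp add: convex_up_closure)
  ultimately show "lower_convex_hull S x \<le> ereal y" by (intro lower_convex_hull_le) auto
qed

lemma convex_hull_halfplane:
  assumes "(x, y) \<in> convex hull S" and "\<And>u v. (u, v) \<in> S \<Longrightarrow> b + a * u \<le> (v :: real)"
  shows "b + a * x \<le> y"
proof -
  have "convex {p :: real \<times> real. inner (a, - 1) p \<le> - b}" by (rule convex_halfspace_le)
  hence "convex hull S \<subseteq> {p. inner (a, - 1) p \<le> - b}"
    using assms(2) by (intro hull_minimal) (auto simp: algebra_simps)
  with assms(1) show ?thesis by (auto simp: algebra_simps)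
qed

lemma lower_convex_hull_halfplane:
  assumes "\<And>u v. (u, v) \<in> S \<Longrightarrow> b + a * u \<le> v"
  shows "ereal (b + a * x) \<le> lower_convex_hull S x"
  by (rule lower_convex_hull_geI) (use assms convex_hull_halfplane in force)

text \<open>The fibre over \<open>x\<close> of the hull of a finite set is compact, so its infimum
  is a minimum. This is what turns real heights of a polygon back into points of the hull.\<close>

lemma lower_convex_hull_attained:
  assumes "finite S" and ne: "\<exists>y. (x, y) \<in> convex hull S"
  obtains y where "lower_convex_hull S x = ereal y" and "(x, y) \<in> convex hull S"
proof -
  define K where "K = snd ` (convex hull S \<inter> {p. fst p = x})"
  have "compact (convex hull S \<inter> {p. fst p = x})"
    using assms(1) by (intro compact_Int_closed compact_convex_hull finite_imp_compact closed_Collect_eq continuous_intros)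
  hence "compact K" unfolding K_def by (intro compact_continuous_image continuous_intros)
  moreover have "K \<noteq> {}" using ne unfolding K_def by force
  ultimately obtain y where y: "y \<in> K" "\<And>z. z \<in> K \<Longrightarrow> y \<le> z"
    using compact_attains_inf[of K] by blast
  have mem: "(x, y) \<in> convex hull S" using y(1) unfolding K_def by auto
  have "lower_convex_hull S x = ereal y"
  proof (rule antisym)
    show "lower_convex_hull S x \<le> ereal y" using mem by (intro lower_convex_hull_le) (auto simp: up_closure_def)
    show "ereal y \<le> lower_convex_hull S x"
      by (rule lower_convex_hull_geI) (use y(2) in \<open>force simp: K_def\<close>)
  qed
  thus thesis using mem that by blast
qed

lemma graph_points_lower_convex_hull:
  assumes "finite S"
  shows "graph_points (lower_convex_hull S) \<subseteq> convex hull S"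
proof
  fix p assume "p \<in> graph_points (lower_convex_hull S)"
  then obtain x y where p: "p = (x, y)" "lower_convex_hull S x = ereal y" unfolding graph_points_def by auto
  have "\<exists>y. (x, y) \<in> convex hull S"
  proof (rule ccontr)
    assume "\<not> ?thesis"
    hence "lower_convex_hull S x = \<infinity>" unfolding lower_convex_hull_def by (simp add: top_ereal_def)
    with p show False by simp
  qed
  from lower_convex_hull_attained[OF assms this] show "p \<in> convex hull S" using p by (metis ereal.inject)
qed

text \<open>Serves to compute the precision polygon directly from the coefficients of the comatrix.
  Each generator lies on or above its own polygon, and by attainment each polygon lies in the hull
  of its generators.\<close>

lemma lower_convex_hull_Union:
  assumes "finite (\<Union>i\<in>I. S i)"
  shows "lower_convex_hull (\<Union>i\<in>I. graph_points (lower_convex_hull (S i))) = lower_convex_hull (\<Union>i\<in>I. S i)"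
    (is "lower_convex_hull ?G = lower_convex_hull ?S")
proof (rule ext, rule antisym)
  fix x
  have fin: "finite (S i)" if "i \<in> I" for i using finite_subset[OF _ assms] that by blast
  show "lower_convex_hull ?G x \<le> lower_convex_hull ?S x"
  proof (rule lower_convex_hull_mono, rule subsetI)
    fix p assume "p \<in> ?S"
    then obtain i u v where i: "i \<in> I" and p: "p = (u, v)" "(u, v) \<in> S i" by (cases p) auto
    obtain w where w: "lower_convex_hull (S i) u = ereal w"
      using lower_convex_hull_attained[OF fin[OF i]] hull_inc[OF p(2)] by metis
    hence "(u, w) \<in> ?G" using i unfolding graph_points_def by auto
    moreover have "w \<le> v" using lower_convex_hull_point_le[OF p(2)] w by simp
    ultimately show "p \<in> up_closure (convex hull ?G)"
      unfolding up_closure_def p(1) by (auto intro: hull_inc)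
  qed
  show "lower_convex_hull ?S x \<le> lower_convex_hull ?G x"
  proof (rule lower_convex_hull_mono, rule subsetI)
    fix p assume "p \<in> ?G"
    then obtain i where "i \<in> I" "p \<in> graph_points (lower_convex_hull (S i))" by auto
    hence "p \<in> convex hull ?S"
      using graph_points_lower_convex_hull[OF fin[of i]] hull_mono[of "S i" ?S convex] by blast
    thus "p \<in> up_closure (convex hull ?S)" unfolding up_closure_def by (cases p) auto
  qed
qed

lemma translate_lower_convex_hull:
  "translate_polygon m (lower_convex_hull S) = lower_convex_hull {(u - m, v) |u v. (u, v) \<in> S}"
proof (rule ext)
  fix x
  have "{(u - m, v) |u v. (u, v) \<in> S} = (\<lambda>p. (- m, 0) + p) ` S" by force
  hence "convex hull {(u - m, v) |u v. (u, v) \<in> S} = (\<lambda>p. (- m, 0) + p) ` (convex hull S)"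
    by (simp add: convex_hull_translation)
  hence "(x, y) \<in> convex hull {(u - m, v) |u v. (u, v) \<in> S} \<longleftrightarrow> (x + m, y) \<in> convex hull S" for y
    by (force simp: image_iff)
  thus "translate_polygon m (lower_convex_hull S) x = lower_convex_hull {(u - m, v) |u v. (u, v) \<in> S} x"
    unfolding translate_polygon_def lower_convex_hull_def by simp
qed

text \<open>A supporting line exists because the separating hyperplane cannot be vertical: the
  abscissa \<open>x\<close> is covered by the hull.\<close>

lemma lower_convex_hull_leI:
  fixes S :: "(real \<times> real) set"
  assumes fin: "finite S" and cover: "(x, y1) \<in> convex hull S"
    and line: "\<And>a b. (\<And>u v. (u, v) \<in> S \<Longrightarrow> b + a * u \<le> v) \<Longrightarrow> b + a * x \<le> y"
  shows "lower_convex_hull S x \<le> ereal y"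
proof (rule ccontr)
  assume gt: "\<not> lower_convex_hull S x \<le> ereal y"
  define R :: "(real \<times> real) set" where "R = {0} \<times> {0..}"
  \<comment> \<open>\<open>E\<close> is the hull with a vertical ray attached to every point. It is
    closed as the sum of a compact and a closed set, which makes strict separation from
    \<open>(x, y)\<close> possible.\<close>
  define E where "E = (\<Union>p\<in>convex hull S. \<Union>r\<in>R. {p + r})"
  have "closed E" unfolding E_def R_def
    using fin by (intro compact_closed_sums compact_convex_hull finite_imp_compact closed_Times) auto
  moreover have "convex E" unfolding E_def R_def
    by (intro convex_sums convex_convex_hull convex_Times) auto
  moreover have "(x, y) \<notin> E"
  proof
    assume "(x, y) \<in> E"
    then obtain u v h where "(u, v) \<in> convex hull S" "0 \<le> h" "(x, y) = (u, v) + (0 :: real, h)"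
      unfolding E_def R_def by auto
    hence "(x, y) \<in> up_closure (convex hull S)"
      unfolding up_closure_def by (auto intro!: exI[of _ v])
    with gt lower_convex_hull_le show False by blast
  qed
  ultimately obtain n c where sep: "inner n (x, y) < c" "\<And>p. p \<in> E \<Longrightarrow> c < inner n p"
    using separating_hyperplane_closed_point[of E "(x, y)"] by blast
  obtain s t where n: "n = (s, t)" by (cases n)
  have up: "c < s * u + t * (v + h)" if "(u, v) \<in> convex hull S" "0 \<le> h" for u v h
    using sep(2)[of "(u, v) + (0, h)"] that unfolding E_def R_def n by force
  have lt: "s * x + t * y < c" using sep(1) by (simp add: n)
  have "0 < t"
  proof (rule ccontr)
    assume "\<not> 0 < t"
    \<comment> \<open>Lifting the covering point \<open>(x, y1)\<close> by \<open>h\<close> brings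
      it to height at least \<open>y\<close>. For \<open>t \<le> 0\<close> the lifted point would
      lie on the wrong side of the separating line.\<close>
    define h where "h = max 0 (y - y1)"
    have "t * (y1 + h) \<le> t * y" using \<open>\<not> 0 < t\<close> by (intro mult_left_mono_neg) (auto simp: h_def)
    moreover have "c < s * x + t * (y1 + h)" by (rule up[OF cover]) (simp add: h_def)
    ultimately show False using lt by simp
  qed
  have "c / t + (- s / t) * x \<le> y"
  proof (rule line)
    fix u v assume "(u, v) \<in> S"
    hence "c < s * u + t * v" using up[of u v 0] by (simp add: hull_inc)
    thus "c / t + (- s / t) * u \<le> v" using \<open>0 < t\<close> by (simp add: field_simps)
  qed
  thus False using lt \<open>0 < t\<close> by (simp add: field_simps)
qed

section \<open>Valuations of determinants\<close>

lemma index_mult_mat_sum: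
  assumes "A \<in> carrier_mat n m" "B \<in> carrier_mat m l" "i < n" "j < l"
  shows "(A * B) $$ (i, j) = (\<Sum>k = 0..<m. A $$ (i, k) * B $$ (k, j))"
  using assms by (simp add: scalar_prod_def)

context complete_dvf
begin

lemma val_zero [simp]: "val 0 = \<infinity>"
  by (simp add: val_eq_infinity_iff)

lemma val_not_MInfty [simp]: "val x \<noteq> -\<infinity>"
proof -
  have "val x \<in> insert \<infinity> (range (\<lambda>k :: int. ereal (real_of_int k)))"
    using range_val by blast
  thus ?thesis by auto
qed

lemma val_real:
  assumes "x \<noteq> 0"
  obtains r where "val x = ereal r"
  using assms val_not_MInfty[of x] val_eq_infinity_iff[of x] by (cases "val x") auto

lemma val_one [simp]: "val 1 = 0"
proof -
  obtain r where r: "val (1 :: 'a) = ereal r" using val_real[of 1] by auto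
  with val_mult[of 1 1] show ?thesis by (simp add: zero_ereal_def)
qed

lemma val_uminus [simp]: "val (- x) = val x"
proof -
  obtain r where r: "val (- 1 :: 'a) = ereal r" using val_real[of "- 1"] by auto
  have "val (- 1 :: 'a) = 0" using val_mult[of "- 1" "- 1"] r by (simp add: zero_ereal_def)
  thus ?thesis using val_mult[of "- 1" x] by simp
qed

lemma val_sum_ge: "(\<And>i. i \<in> A \<Longrightarrow> c \<le> val (f i)) \<Longrightarrow> c \<le> val (sum f A)"
proof (induction A rule: infinite_finite_induct)
  case (insert a A)
  hence "c \<le> min (val (f a)) (val (sum f A))" by simp
  also have "\<dots> \<le> val (f a + sum f A)" by (rule val_add)
  finally show ?case using insert.hyps by simp
qed auto

lemma val_sum_gt: "c < \<infinity> \<Longrightarrow> (\<And>i. i \<in> A \<Longrightarrow> c < val (f i)) \<Longrightarrow> c < val (sum f A)"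
proof (induction A rule: infinite_finite_induct)
  case (insert a A)
  hence "c < min (val (f a)) (val (sum f A))" by simp
  also have "\<dots> \<le> val (f a + sum f A)" by (rule val_add)
  finally show ?case using insert.hyps by simp
qed auto

lemma val_add_eq:
  assumes "val x < val y"
  shows "val (x + y) = val x"
proof (rule antisym)
  show "val x \<le> val (x + y)" using val_add[of x y] assms by simp
  have "min (val (x + y)) (val (- y)) \<le> val x" using val_add[of "x + y" "- y"] by simp
  thus "val (x + y) \<le> val x" using assms by (auto simp: min_def split: if_splits)
qed

lemma val_prod: "val (prod f A) = (\<Sum>i\<in>A. val (f i))"
  by (induction A rule: infinite_finite_induct) (simp_all add: val_mult)

lemma val_signof_mult [simp]: "val (signof p * x) = val x"
  by (cases "evenperm p") (simp_all add: sign_def)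

lemma val_minus_one_power_mult [simp]: "val ((- 1) ^ k * x) = val x"
  by (cases "even k") simp_all

lemma val_det_ge_0:
  assumes A: "A \<in> carrier_mat n n" and int: "\<And>i j. i < n \<Longrightarrow> j < n \<Longrightarrow> 0 \<le> val (A $$ (i, j))"
  shows "0 \<le> val (det A)"
  unfolding det_def'[OF A]
  by (intro val_sum_ge) (auto simp: val_prod intro!: sum_nonneg int dest: permutes_in_image)

lemma coeff_sum_ge:
  assumes "\<And>i. i \<in> A \<Longrightarrow> c \<le> val (coeff (f i) k)"
  shows "c \<le> val (coeff (sum f A) k)"
  by (auto simp: coeff_sum intro: val_sum_ge assms)

lemma coeff_signof_mult: "val (coeff (signof p * f) k) = val (coeff f k)"
  by (cases "evenperm p") (simp_all add: sign_def)

lemma coeff_minus_one_power_mult: "val (coeff ((- 1) ^ i * f) k) = val (coeff f k)"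
  by (cases "even i") simp_all

lemma coeff_det_ge:
  assumes P: "P \<in> carrier_mat n n"
    and "\<And>p. p permutes {0..<n} \<Longrightarrow> c \<le> val (coeff (\<Prod>i = 0..<n. P $$ (i, p i)) k)"
  shows "c \<le> val (coeff (det P) k)"
  unfolding det_def'[OF P] using assms(2) by (intro coeff_sum_ge) (auto simp: coeff_signof_mult)

text \<open>The minimum over \<open>j\<close> of \<open>val (coeff f j) - t j\<close> is a Gauss
  weight. It is superadditive under products because the degrees add in each term of the
  convolution.\<close>

lemma coeff_prod_weighted:
  fixes b t :: real
  assumes "finite A" and "\<And>i j. i \<in> A \<Longrightarrow> ereal (b + t * real j) \<le> val (coeff (f i) j)"
  shows "ereal (real (card A) * b + t * real j) \<le> val (coeff (prod f A) j)"
  using assms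
proof (induction A arbitrary: j rule: finite_induct)
  case empty
  thus ?case by (cases j) (auto simp: zero_ereal_def[symmetric])
next
  case (insert a A)
  have "ereal (real (card (insert a A)) * b + t * real j) \<le> val (coeff (f a) i * coeff (prod f A) (j - i))"
    if "i \<le> j" for i
  proof -
    have "ereal (real (card (insert a A)) * b + t * real j)
        = ereal (b + t * real i) + ereal (real (card A) * b + t * real (j - i))"
      using insert.hyps that by (simp add: algebra_simps of_nat_diff)
    also have "\<dots> \<le> val (coeff (f a) i) + val (coeff (prod f A) (j - i))"
      using insert by (intro add_mono) auto
    finally show ?thesis by (simp add: val_mult)
  qed
  thus ?case using insert.hyps by (auto simp: coeff_mult intro!: val_sum_ge)
qed

lemma coeff_det_weighted:
  fixes b t :: real
  assumes P: "P \<in> carrier_mat n n"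
    and bd: "\<And>i j k. i < n \<Longrightarrow> j < n \<Longrightarrow> ereal (b + t * real k) \<le> val (coeff (P $$ (i, j)) k)"
  shows "ereal (real n * b + t * real k) \<le> val (coeff (det P) k)"
proof (rule coeff_det_ge[OF P])
  fix p assume "p permutes {0..<n}"
  hence "p i < n" if "i < n" for i using that permutes_in_image[of p "{0..<n}" i] by simp
  thus "ereal (real n * b + t * real k) \<le> val (coeff (\<Prod>i = 0..<n. P $$ (i, p i)) k)"
    using coeff_prod_weighted[of "{0..<n}" b t "\<lambda>i. P $$ (i, p i)" k] bd by auto
qed

text \<open>A term of degree \<open>k\<close> in the product takes \<open>X\<close> from
  \<open>k\<close> factors and the constant term from the other \<open>m - k\<close>. As
  \<open>\<tau>\<close> is nondecreasing, its first \<open>m - k\<close> values have the least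
  sum.\<close>

lemma coeff_prod_linear:
  assumes "\<And>r. r < m \<Longrightarrow> degree (f r) \<le> 1"
    and "\<And>r. r < m \<Longrightarrow> 0 \<le> val (coeff (f r) 1)"
    and "\<And>r. r < m \<Longrightarrow> \<tau> r \<le> val (coeff (f r) 0)"
    and "\<And>r s. r \<le> s \<Longrightarrow> s < m \<Longrightarrow> \<tau> r \<le> \<tau> s"
  shows "degree (\<Prod>r = 0..<m. f r) \<le> m \<and>
    (\<forall>k \<le> m. (\<Sum>j<m - k. \<tau> j) \<le> val (coeff (\<Prod>r = 0..<m. f r) k))"
  using assms
proof (induction m)
  case (Suc m)
  define q where "q = (\<Prod>r = 0..<m. f r)"
  have q: "degree q \<le> m" "\<And>k. k \<le> m \<Longrightarrow> (\<Sum>j<m - k. \<tau> j) \<le> val (coeff q k)"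
    using Suc.IH Suc.prems unfolding q_def by auto
  define a b where "a = coeff (f m) 0" and "b = coeff (f m) 1"
  have "coeff (f m) k = coeff [:a, b:] k" for k
    using Suc.prems(1)[of m] by (cases k) (auto simp: a_def b_def coeff_pCons coeff_eq_0 split: nat.split)
  hence fm: "f m = [:a, b:]" by (rule poly_eqI)
  have ab: "\<tau> m \<le> val a" "0 \<le> val b" using Suc.prems unfolding a_def b_def by auto
  have prod: "(\<Prod>r = 0..<Suc m. f r) = smult a q + pCons 0 (smult b q)"
    by (simp add: q_def fm mult.commute)
  have deg: "degree (f m * q) \<le> Suc m"
    using degree_mult_le[of "f m" q] q(1) Suc.prems(1)[of m] by simp
  have "(\<Sum>j<Suc m - k. \<tau> j) \<le> val (coeff (smult a q + pCons 0 (smult b q)) k)" if "k \<le> Suc m" for k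
  proof -
    have "(\<Sum>j<Suc m - k. \<tau> j) \<le> val (a * coeff q k)"
    proof (cases "k \<le> m")
      case True
      \<comment> \<open>The constant term of the last factor has valuation at least
        \<open>\<tau> m\<close>, and monotonicity trades this for the missing summand
        \<open>\<tau> (m - k)\<close>.\<close>
      have "(\<Sum>j<Suc m - k. \<tau> j) = \<tau> (m - k) + (\<Sum>j<m - k. \<tau> j)"
        using True by (simp add: Suc_diff_le add.commute)
      also have "\<dots> \<le> val a + val (coeff q k)"
        using order.trans[OF Suc.prems(4)[of "m - k" m] ab(1)] q(2)[OF True] by (intro add_mono) auto
      finally show ?thesis by (simp add: val_mult)
    next
      case False
      thus ?thesis using q(1) by (simp add: coeff_eq_0)
    qed
    moreover have "(\<Sum>j<Suc m - k. \<tau> j) \<le> val (coeff (pCons 0 (smult b q)) k)"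
    proof (cases k)
      case (Suc i)
      hence "(\<Sum>j<Suc m - k. \<tau> j) \<le> 0 + val (coeff q i)" using q(2)[of i] that by simp
      also have "\<dots> \<le> val b + val (coeff q i)" using ab(2) by (rule add_right_mono)
      finally show ?thesis using Suc by (simp add: val_mult)
    qed simp
    ultimately show ?thesis using val_add[of "a * coeff q k" "coeff (pCons 0 (smult b q)) k"]
      by (auto simp: min_def split: if_splits)
  qed
  thus ?case using deg prod by (simp add: q_def mult.commute)
qed auto

text \<open>The bound on constant terms depends on the row only, so every permutation in the Leibniz
  formula yields the same estimate. The value \<open>\<infinity>\<close> for \<open>k > m\<close>
  says that the coefficient vanishes.\<close>

lemma coeff_det_linear:
  assumes P: "P \<in> carrier_mat m m"
    and deg: "\<And>i j. i < m \<Longrightarrow> j < m \<Longrightarrow> degree (P $$ (i, j)) \<le> 1"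
    and c1: "\<And>i j. i < m \<Longrightarrow> j < m \<Longrightarrow> 0 \<le> val (coeff (P $$ (i, j)) 1)"
    and c0: "\<And>i j. i < m \<Longrightarrow> j < m \<Longrightarrow> \<tau> i \<le> val (coeff (P $$ (i, j)) 0)"
    and mono: "\<And>r s. r \<le> s \<Longrightarrow> s < m \<Longrightarrow> \<tau> r \<le> \<tau> s"
  shows "(if k \<le> m then \<Sum>j<m - k. \<tau> j else \<infinity>) \<le> val (coeff (det P) k)"
proof (rule coeff_det_ge[OF P])
  fix p assume "p permutes {0..<m}"
  hence p: "p i < m" if "i < m" for i using that permutes_in_image[of p "{0..<m}" i] by simp
  have "degree (\<Prod>r = 0..<m. P $$ (r, p r)) \<le> m \<and>
    (\<forall>k \<le> m. (\<Sum>j<m - k. \<tau> j) \<le> val (coeff (\<Prod>r = 0..<m. P $$ (r, p r)) k))"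
    by (rule coeff_prod_linear) (use deg c1 c0 mono p in auto)
  thus "(if k \<le> m then \<Sum>j<m - k. \<tau> j else \<infinity>) \<le> val (coeff (\<Prod>i = 0..<m. P $$ (i, p i)) k)"
    by (auto simp: coeff_eq_0)
qed

text \<open>Only the identity permutation reaches valuation \<open>n v\<close>. Any other one uses
  an off-diagonal entry, whose valuation is strictly larger than \<open>v\<close>, so the leading
  term cannot cancel.\<close>

lemma val_det_perturbed_scalar:
  fixes v :: real
  assumes a: "val a = ereal v" and E: "E \<in> carrier_mat n n"
    and gt: "\<And>i j. i < n \<Longrightarrow> j < n \<Longrightarrow> ereal v < val (E $$ (i, j))"
  shows "val (det (a \<cdot>\<^sub>m 1\<^sub>m n - E)) = ereal (real n * v)"
proof -
  define B where "B = a \<cdot>\<^sub>m 1\<^sub>m n - E"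
  have B: "B \<in> carrier_mat n n" using E unfolding B_def by auto
  have diag: "val (B $$ (i, i)) = ereal v" if "i < n" for i
    using val_add_eq[of a "- (E $$ (i, i))"] gt[OF that that] that E a by (simp add: B_def)
  have off: "ereal v < val (B $$ (i, j))" if "i < n" "j < n" "i \<noteq> j" for i j
    using gt[OF that(1,2)] that E by (simp add: B_def)
  have "ereal (real n * v) < val (signof p * (\<Prod>i = 0..<n. B $$ (i, p i)))"
    if p: "p permutes {0..<n}" "p \<noteq> id" for p
  proof -
    obtain i where i: "p i \<noteq> i" using p(2) by (auto simp: fun_eq_iff)
    have lt: "p i < n" if "i < n" for i using that permutes_in_image[OF p(1), of i] by simp
    have i': "i < n" using i permutes_not_in[OF p(1), of i] by auto
    have ge: "ereal v \<le> val (B $$ (j, p j))" if "j < n" for j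
      using diag[of j] off[OF that lt[OF that]] that by (cases "p j = j") auto
    have "ereal (real (n - 1) * v) = (\<Sum>j\<in>{0..<n} - {i}. ereal v)"
      using i' by simp
    also have "\<dots> \<le> (\<Sum>j\<in>{0..<n} - {i}. val (B $$ (j, p j)))"
      by (intro sum_mono ge) auto
    finally have "ereal (real n * v) < val (B $$ (i, p i)) + (\<Sum>j\<in>{0..<n} - {i}. val (B $$ (j, p j)))"
      using off[OF i' lt[OF i'] i[symmetric]] i'
      by (cases "val (B $$ (i, p i))"; cases "\<Sum>j\<in>{0..<n} - {i}. val (B $$ (j, p j))")
         (auto simp: of_nat_diff algebra_simps)
    also have "\<dots> = val (\<Prod>i = 0..<n. B $$ (i, p i))"
      using i' by (simp add: val_prod sum.remove[of _ i])
    finally show ?thesis by simp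
  qed
  hence rest: "ereal (real n * v) < val (\<Sum>p\<in>{p. p permutes {0..<n}} - {id}. signof p * (\<Prod>i = 0..<n. B $$ (i, p i)))"
    by (intro val_sum_gt) auto
  have id: "val (signof id * (\<Prod>i = 0..<n. B $$ (i, id i))) = ereal (real n * v)"
    by (simp add: val_prod diag del: sign_id)
  have "det B = signof id * (\<Prod>i = 0..<n. B $$ (i, id i)) +
    (\<Sum>p\<in>{p. p permutes {0..<n}} - {id}. signof p * (\<Prod>i = 0..<n. B $$ (i, p i)))"
    unfolding det_def'[OF B]
    by (rule sum.remove) (auto simp: permutes_id finite_permutations)
  thus ?thesis using val_add_eq rest unfolding id[symmetric] B_def by simp
qed

end

section \<open>Coefficient matrices of the comatrix and their recursion\<close>

definition Com_coeff :: "'a :: field mat \<Rightarrow> nat \<Rightarrow> 'a mat" where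
  "Com_coeff M k = map_mat (\<lambda>f. coeff f k) (Com M)"

lemma hom_const_poly: "comm_ring_hom (\<lambda>x :: 'a :: comm_ring_1. [:x:])"
  by unfold_locales (auto simp: one_pCons)

lemma det_const_poly: "det (map_mat (\<lambda>x :: 'a :: comm_ring_1. [:x:]) A) = [:det A:]"
proof -
  interpret comm_ring_hom "\<lambda>x :: 'a. [:x:]" by (rule hom_const_poly)
  show ?thesis by (rule hom_det)
qed

lemma Com_carrier [simp]: "M \<in> carrier_mat n n \<Longrightarrow> Com M \<in> carrier_mat n n"
  unfolding Com_def by (intro adj_mat(1)) simp

lemma Com_coeff_carrier [simp]: "M \<in> carrier_mat n n \<Longrightarrow> Com_coeff M k \<in> carrier_mat n n"
  unfolding Com_coeff_def by simp

lemma Com_coeff_index: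
  "M \<in> carrier_mat n n \<Longrightarrow> i < n \<Longrightarrow> j < n \<Longrightarrow> Com_coeff M k $$ (i, j) = coeff (Com M $$ (i, j)) k"
  using carrier_matD[OF Com_carrier[of M n]] by (simp add: Com_coeff_def)

lemma char_poly_matrix_mult_index:
  assumes M: "M \<in> carrier_mat n n" and B: "B \<in> carrier_mat n n" and ij: "i < n" "j < n"
  shows "(char_poly_matrix M * B) $$ (i, j) =
    pCons 0 (B $$ (i, j)) - (\<Sum>l = 0..<n. smult (M $$ (i, l)) (B $$ (l, j)))"
proof -
  have "(char_poly_matrix M * B) $$ (i, j) = (\<Sum>l = 0..<n. char_poly_matrix M $$ (i, l) * B $$ (l, j))"
    using char_poly_matrix_closed[OF M] B ij by (simp add: times_mat_def scalar_prod_def)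
  also have "\<dots> = (\<Sum>l = 0..<n. (if l = i then pCons 0 (B $$ (l, j)) else 0) - smult (M $$ (i, l)) (B $$ (l, j)))"
    using M ij by (intro sum.cong) (auto simp: char_poly_matrix_def)
  also have "\<dots> = pCons 0 (B $$ (i, j)) - (\<Sum>l = 0..<n. smult (M $$ (i, l)) (B $$ (l, j)))"
    using ij by (simp add: sum_subtractf)
  finally show ?thesis .
qed

text \<open>Comparison of the coefficients of \<open>X^k\<close> in
  \<open>(X - M) Com M = char_poly M I\<close>. The zero matrix at \<open>k = 0\<close> plays the
  part of the coefficient of index \<open>-1\<close>.\<close>

lemma mult_Com_coeff:
  assumes M: "M \<in> carrier_mat n n"
  shows "M * Com_coeff M k =
    (if k = 0 then 0\<^sub>m n n else Com_coeff M (k - 1)) - coeff (char_poly M) k \<cdot>\<^sub>m 1\<^sub>m n"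
proof (rule eq_matI)
  fix i j assume "i < dim_row ((if k = 0 then 0\<^sub>m n n else Com_coeff M (k - 1)) - coeff (char_poly M) k \<cdot>\<^sub>m 1\<^sub>m n)"
    "j < dim_col ((if k = 0 then 0\<^sub>m n n else Com_coeff M (k - 1)) - coeff (char_poly M) k \<cdot>\<^sub>m 1\<^sub>m n)"
  hence ij: "i < n" "j < n" by auto
  have "char_poly_matrix M * Com M = char_poly M \<cdot>\<^sub>m 1\<^sub>m n"
    unfolding Com_def char_poly_def by (rule adj_mat(2)) (use M in simp)
  hence "pCons 0 (Com M $$ (i, j)) - (\<Sum>l = 0..<n. smult (M $$ (i, l)) (Com M $$ (l, j)))
      = (if i = j then char_poly M else 0)"
    using char_poly_matrix_mult_index[OF M Com_carrier[OF M] ij] ij by (cases "i = j") auto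
  from arg_cong[OF this, of "\<lambda>f. coeff f k"]
  have "coeff (pCons 0 (Com M $$ (i, j))) k - (\<Sum>l = 0..<n. M $$ (i, l) * coeff (Com M $$ (l, j)) k)
      = (if i = j then coeff (char_poly M) k else 0)"
    by (simp add: coeff_sum)
  note eq = this[symmetric]
  have "(\<Sum>l = 0..<n. M $$ (i, l) * coeff (Com M $$ (l, j)) k)
      = coeff (pCons 0 (Com M $$ (i, j))) k - (if i = j then coeff (char_poly M) k else 0)"
    unfolding eq by simp
  moreover have "(M * Com_coeff M k) $$ (i, j) = (\<Sum>l = 0..<n. M $$ (i, l) * coeff (Com M $$ (l, j)) k)"
    using M ij carrier_matD[OF Com_carrier[OF M]] by (simp add: times_mat_def scalar_prod_def Com_coeff_def)
  ultimately show "(M * Com_coeff M k) $$ (i, j) = ((if k = 0 then 0\<^sub>m n n else Com_coeff M (k - 1))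
      - coeff (char_poly M) k \<cdot>\<^sub>m 1\<^sub>m n) $$ (i, j)"
    using ij Com_coeff_carrier[OF M] Com_coeff_index[OF M ij] carrier_matD[OF Com_coeff_carrier[OF M]]
    by (cases k) (auto simp: algebra_simps simp del: index_mult_mat)
qed (use M carrier_matD[OF Com_coeff_carrier[OF M]] in auto)

context complete_dvf
begin

text \<open>Estimates \<open>det ((X - M) N) = char_poly M * det N\<close>, whose constant term has valuation exactly \<open>n v\<close>.
  This replaces reasoning about the eigenvalues of \<open>M\<close> or the entries of its inverse.\<close>

lemma coeff_char_poly_ge:
  fixes v c :: real
  assumes M: "M \<in> carrier_mat n n" and N: "N \<in> carrier_mat n n" and E: "E \<in> carrier_mat n n"
    and MN: "M * N = E - a \<cdot>\<^sub>m 1\<^sub>m n"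
    and a: "val a = ereal v"
    and E_gt: "\<And>i j. i < n \<Longrightarrow> j < n \<Longrightarrow> ereal v < val (E $$ (i, j))"
    and N_ge: "\<And>i j. i < n \<Longrightarrow> j < n \<Longrightarrow> ereal c \<le> val (N $$ (i, j))"
  obtains u where "val (coeff (char_poly M) 0) = ereal u"
    and "\<And>k. ereal (u + real k * (c - v)) \<le> val (coeff (char_poly M) k)"
proof -
  define P where "P = char_poly_matrix M * map_mat (\<lambda>x. [:x:]) N"
  have P: "P \<in> carrier_mat n n" unfolding P_def using M N by (intro mult_carrier_mat[of _ n n]) auto
  have detP: "det P = smult (det N) (char_poly M)"
    using det_mult[of "char_poly_matrix M" n "map_mat (\<lambda>x. [:x:]) N"] M N
    unfolding P_def by (simp add: det_const_poly char_poly_def)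
  have entry: "P $$ (i, j) = [:- (E - a \<cdot>\<^sub>m 1\<^sub>m n) $$ (i, j), N $$ (i, j):]" if ij: "i < n" "j < n" for i j
  proof -
    have "(E - a \<cdot>\<^sub>m 1\<^sub>m n) $$ (i, j) = (\<Sum>l = 0..<n. M $$ (i, l) * N $$ (l, j))"
      unfolding MN[symmetric] using M N ij by (simp add: times_mat_def scalar_prod_def)
    moreover have "(\<Sum>l = 0..<n. smult (M $$ (i, l)) (map_mat (\<lambda>x. [:x:]) N $$ (l, j)))
       = [:\<Sum>l = 0..<n. M $$ (i, l) * N $$ (l, j):]"
      using N ij by (intro poly_eqI) (simp add: coeff_sum coeff_pCons split: nat.split)
    ultimately show ?thesis
      using char_poly_matrix_mult_index[OF M, of "map_mat (\<lambda>x. [:x:]) N" i j] N ij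
      unfolding P_def by simp
  qed
  have E_ge: "ereal v \<le> val (- (E - a \<cdot>\<^sub>m 1\<^sub>m n) $$ (i, j))" if ij: "i < n" "j < n" for i j
  proof -
    have "min (val (E $$ (i, j))) (val (- (if i = j then a else 0))) \<le> val (E $$ (i, j) + - (if i = j then a else 0))"
      by (rule val_add)
    moreover have "ereal v \<le> min (val (E $$ (i, j))) (val (- (if i = j then a else 0)))"
      using E_gt[OF ij] a by auto
    moreover have "val (- (E - a \<cdot>\<^sub>m 1\<^sub>m n) $$ (i, j)) = val (E $$ (i, j) + - (if i = j then a else 0))"
      unfolding val_uminus using E ij by simp
    ultimately show ?thesis by order
  qed
  \<comment> \<open>An entry of \<open>P\<close> is linear in \<open>X\<close>. The weight is the
    line with height \<open>v\<close> at index 0 and \<open>c\<close> at index 1, so it fits the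
    bounds on both coefficients.\<close>
  have w: "ereal (v + (c - v) * real k) \<le> val (coeff (P $$ (i, j)) k)" if ij: "i < n" "j < n" for i j k
    using E_ge[OF ij] N_ge[OF ij] unfolding entry[OF ij] by (auto simp: coeff_pCons split: nat.split)
  have bd: "ereal (real n * v + (c - v) * real k) \<le> val (det N) + val (coeff (char_poly M) k)" for k
    using coeff_det_weighted[OF P w, of k] by (simp add: detP val_mult)
  \<comment> \<open>At \<open>X = 0\<close> the matrix \<open>(X - M) N\<close> becomes
    \<open>- M N = a - E\<close>. Hence the valuations of \<open>det N\<close> and of the constant
    coefficient add up to exactly \<open>n v\<close>, so both are finite and
    \<open>val (det N)\<close> can be subtracted from \<open>bd\<close>.\<close>
  have "poly (det P) 0 = det (a \<cdot>\<^sub>m 1\<^sub>m n - E)"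
    by (rule poly_det_cong[OF _ P]) (use E entry in auto)
  hence eq: "val (det N) + val (coeff (char_poly M) 0) = ereal (real n * v)"
    using val_det_perturbed_scalar[OF a E E_gt] by (simp add: detP poly_0_coeff_0 flip: val_mult)
  then obtain u where u: "val (coeff (char_poly M) 0) = ereal u"
    using val_not_MInfty[of "det N"] val_not_MInfty[of "coeff (char_poly M) 0"]
    by (cases "val (det N)"; cases "val (coeff (char_poly M) 0)") auto
  have d: "val (det N) = ereal (real n * v - u)"
    using eq u by (cases "val (det N)") auto
  show ?thesis
  proof (rule that[OF u])
    fix k
    show "ereal (u + real k * (c - v)) \<le> val (coeff (char_poly M) k)"
      using bd[of k] unfolding d by (cases "val (coeff (char_poly M) k)") (auto simp: algebra_simps)
  qed
qed

end

section \<open>Smith decomposition\<close>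

context complete_dvf
begin

lemma integral_index:
  assumes "A \<in> carrier_mat n m" "elements_mat A \<subseteq> integers_of val" "i < n" "j < m"
  shows "0 \<le> val (A $$ (i, j))"
  using assms unfolding integers_of_def by blast

lemma integral_mult:
  assumes "A \<in> carrier_mat n m" "elements_mat A \<subseteq> integers_of val"
    and "B \<in> carrier_mat m l" "elements_mat B \<subseteq> integers_of val"
  shows "elements_mat (A * B) \<subseteq> integers_of val"
proof
  fix x assume "x \<in> elements_mat (A * B)"
  then obtain i j where ij: "i < n" "j < l" and x: "x = (A * B) $$ (i, j)" using assms by auto
  have "x = (\<Sum>k = 0..<m. A $$ (i, k) * B $$ (k, j))"
    using assms ij by (simp add: x times_mat_def scalar_prod_def)
  moreover have "0 \<le> val (A $$ (i, k))" "0 \<le> val (B $$ (k, j))" if "k < m" for k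
    using assms ij that unfolding integers_of_def by auto
  ultimately show "x \<in> integers_of val"
    unfolding integers_of_def by (auto simp: val_mult intro!: val_sum_ge)
qed

lemma integral_one: "elements_mat (1\<^sub>m n :: 'a mat) \<subseteq> integers_of val"
  by (auto simp: integers_of_def)

lemma integral_uminus:
  assumes "elements_mat A \<subseteq> integers_of val"
  shows "elements_mat (- A) \<subseteq> integers_of val"
proof
  fix x assume "x \<in> elements_mat (- A)"
  then obtain i j where ij: "i < dim_row A" "j < dim_col A" and x: "x = - A $$ (i, j)" by fastforce
  have "A $$ (i, j) \<in> elements_mat A" using ij by (intro elements_matI[of A "dim_row A" "dim_col A"]) auto
  thus "x \<in> integers_of val" using assms ij by (auto simp: integers_of_def x)
qed

lemma unimodularI:
  assumes "U \<in> carrier_mat n n" "elements_mat U \<subseteq> integers_of val"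
    and "W \<in> carrier_mat n n" "elements_mat W \<subseteq> integers_of val"
    and "U * W = 1\<^sub>m n"
  shows "unimodular val n U"
proof -
  have "W * U = 1\<^sub>m n" using mat_mult_left_right_inverse assms by blast
  thus ?thesis using assms unfolding unimodular_def inverts_mat_def by auto
qed

lemma unimodularE:
  assumes "unimodular val n U"
  obtains W where "U \<in> carrier_mat n n" "elements_mat U \<subseteq> integers_of val"
    "W \<in> carrier_mat n n" "elements_mat W \<subseteq> integers_of val" "U * W = 1\<^sub>m n" "W * U = 1\<^sub>m n"
  using assms unfolding unimodular_def inverts_mat_def by auto

lemma unimodular_one: "unimodular val n (1\<^sub>m n)"
  by (rule unimodularI[OF _ integral_one _ integral_one]) auto

lemma unimodular_mult:
  assumes "unimodular val n U" "unimodular val n V"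
  shows "unimodular val n (U * V)"
proof -
  obtain U' where U: "U \<in> carrier_mat n n" "elements_mat U \<subseteq> integers_of val"
    "U' \<in> carrier_mat n n" "elements_mat U' \<subseteq> integers_of val" "U * U' = 1\<^sub>m n"
    using assms(1) by (rule unimodularE)
  obtain V' where V: "V \<in> carrier_mat n n" "elements_mat V \<subseteq> integers_of val"
    "V' \<in> carrier_mat n n" "elements_mat V' \<subseteq> integers_of val" "V * V' = 1\<^sub>m n"
    using assms(2) by (rule unimodularE)
  have "(U * V) * (V' * U') = U * (V * V') * U'"
    using U(1,3) V(1,3) by (simp add: assoc_mult_mat[of _ n n _ n _ n])
  also have "\<dots> = 1\<^sub>m n" unfolding V(5) using U by simp
  finally show ?thesis
    using U V by (intro unimodularI[where W = "V' * U'"] integral_mult[of _ n n _ n]) auto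
qed

lemma unimodular_swaprows_mat:
  assumes "k < n" "l < n"
  shows "unimodular val n (swaprows_mat n k l)"
proof (rule unimodularI)
  show "elements_mat (swaprows_mat n k l :: 'a mat) \<subseteq> integers_of val"
    by (auto simp: integers_of_def)
  thus "elements_mat (swaprows_mat n k l :: 'a mat) \<subseteq> integers_of val" .
qed (use assms in \<open>auto simp: swaprows_mat_inv\<close>)

lemma unimodular_block:
  assumes "unimodular val n U"
  shows "unimodular val (Suc n) (four_block_mat (1\<^sub>m 1) (0\<^sub>m 1 n) (0\<^sub>m n 1) U)"
proof -
  obtain W where U: "U \<in> carrier_mat n n" "elements_mat U \<subseteq> integers_of val"
    "W \<in> carrier_mat n n" "elements_mat W \<subseteq> integers_of val" "U * W = 1\<^sub>m n"
    using assms by (rule unimodularE)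
  have int: "elements_mat (four_block_mat (1\<^sub>m 1) (0\<^sub>m 1 n) (0\<^sub>m n 1) A) \<subseteq> integers_of val"
    if "A \<in> carrier_mat n n" "elements_mat A \<subseteq> integers_of val" for A
    using that integral_one[of 1] elements_0_mat[of 1 n] elements_0_mat[of n 1]
    by (intro order.trans[OF elements_four_block_mat[of _ 1 1 _ n _ n]]) (auto simp: integers_of_def)
  have "four_block_mat (1\<^sub>m 1) (0\<^sub>m 1 n) (0\<^sub>m n 1) U * four_block_mat (1\<^sub>m 1) (0\<^sub>m 1 n) (0\<^sub>m n 1) W = 1\<^sub>m (1 + n)"
    using U by (subst mult_four_block_mat[of _ 1 1 _ n _ n _ _ 1 _ n]) auto
  thus ?thesis
    by (intro unimodularI[where W = "four_block_mat (1\<^sub>m 1) (0\<^sub>m 1 n) (0\<^sub>m n 1) W"] int)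
       (use U in auto)
qed

lemma unimodular_lower:
  assumes C: "C \<in> carrier_mat n 1" and int: "elements_mat C \<subseteq> integers_of val"
  shows "unimodular val (Suc n) (four_block_mat (1\<^sub>m 1) (0\<^sub>m 1 n) C (1\<^sub>m n))"
proof -
  have I: "elements_mat (four_block_mat (1\<^sub>m 1) (0\<^sub>m 1 n) A (1\<^sub>m n)) \<subseteq> integers_of val"
    if "A \<in> carrier_mat n 1" "elements_mat A \<subseteq> integers_of val" for A
    using that integral_one[of 1] integral_one[of n] elements_0_mat[of 1 n]
    by (intro order.trans[OF elements_four_block_mat[of _ 1 1 _ n _ n]]) (auto simp: integers_of_def)
  have "four_block_mat (1\<^sub>m 1) (0\<^sub>m 1 n) C (1\<^sub>m n) * four_block_mat (1\<^sub>m 1) (0\<^sub>m 1 n) (- C) (1\<^sub>m n) = 1\<^sub>m (1 + n)"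
    using C by (subst mult_four_block_mat[of _ 1 1 _ n _ n _ _ 1 _ n]) (auto intro!: eq_matI)
  thus ?thesis
    by (intro unimodularI[where W = "four_block_mat (1\<^sub>m 1) (0\<^sub>m 1 n) (- C) (1\<^sub>m n)"] I)
       (use C int integral_uminus[OF int] in auto)
qed

lemma unimodular_upper:
  assumes C: "C \<in> carrier_mat 1 n" and int: "elements_mat C \<subseteq> integers_of val"
  shows "unimodular val (Suc n) (four_block_mat (1\<^sub>m 1) C (0\<^sub>m n 1) (1\<^sub>m n))"
proof -
  have I: "elements_mat (four_block_mat (1\<^sub>m 1) A (0\<^sub>m n 1) (1\<^sub>m n)) \<subseteq> integers_of val"
    if "A \<in> carrier_mat 1 n" "elements_mat A \<subseteq> integers_of val" for A
    using that integral_one[of 1] integral_one[of n] elements_0_mat[of n 1]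
    by (intro order.trans[OF elements_four_block_mat[of _ 1 1 _ n _ n]]) (auto simp: integers_of_def)
  have "four_block_mat (1\<^sub>m 1) C (0\<^sub>m n 1) (1\<^sub>m n) * four_block_mat (1\<^sub>m 1) (- C) (0\<^sub>m n 1) (1\<^sub>m n) = 1\<^sub>m (1 + n)"
    using C by (subst mult_four_block_mat[of _ 1 1 _ n _ n _ _ 1 _ n]) (auto intro!: eq_matI)
  thus ?thesis
    by (intro unimodularI[where W = "four_block_mat (1\<^sub>m 1) (- C) (0\<^sub>m n 1) (1\<^sub>m n)"] I)
       (use C int integral_uminus[OF int] in auto)
qed

lemma val_divide_ge_0: "val b \<le> val a \<Longrightarrow> 0 \<le> val (a / b)"
proof (cases "b = 0")
  case False
  assume le: "val b \<le> val a"
  have "val a = val (a / b) + val b" using False val_mult[of "a / b" b] by simp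
  moreover obtain r where "val b = ereal r" using val_real[OF False] .
  ultimately show ?thesis using le by (cases "val (a / b)") auto
qed simp

lemma val_mult_mat_ge:
  assumes A: "A \<in> carrier_mat n m" and B: "B \<in> carrier_mat m l" and ij: "i < n" "j < l"
    and ge: "\<And>k. k < m \<Longrightarrow> c \<le> val (A $$ (i, k)) + val (B $$ (k, j))"
  shows "c \<le> val ((A * B) $$ (i, j))"
proof -
  have "(A * B) $$ (i, j) = (\<Sum>k = 0..<m. A $$ (i, k) * B $$ (k, j))"
    using A B ij by (simp add: times_mat_def scalar_prod_def)
  thus ?thesis using ge by (auto simp: val_mult intro!: val_sum_ge)
qed

text \<open>Gaussian elimination with a pivot of least valuation: quotients by the pivot are
  integral, so the eliminating matrices are unimodular. Existence is what gives meaning to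
  \<open>smith_diagonal\<close>, which is a choice.\<close>

lemma smith_decomposition_exists:
  assumes "M \<in> carrier_mat n n"
  shows "\<exists>U D V. smith_decomposition val M U D V"
  using assms
proof (induction n arbitrary: M)
  case 0
  hence "smith_decomposition val M (1\<^sub>m 0) (1\<^sub>m 0) (1\<^sub>m 0)"
    unfolding smith_decomposition_def by (auto simp: diagonal_mat_def unimodular_one)
  thus ?case by blast
next
  case (Suc n)
  define I where "I = {0..<Suc n} \<times> {0..<Suc n}"
  obtain p where p: "p \<in> I" "\<And>q. q \<in> I \<Longrightarrow> val (M $$ p) \<le> val (M $$ q)"
    using ex_min_if_finite[of "(\<lambda>q. val (M $$ q)) ` I"] unfolding I_def
    by (fastforce simp: not_less)
  obtain r s where rs: "p = (r, s)" "r < Suc n" "s < Suc n" using p(1) unfolding I_def by auto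
  define S T :: "'a mat" where "S = swaprows_mat (Suc n) 0 r" and "T = swaprows_mat (Suc n) 0 s"
  define N where "N = swapcols 0 s (swaprows 0 r M)"
  have N: "N \<in> carrier_mat (Suc n) (Suc n)" using Suc.prems unfolding N_def by auto
  have ST: "S \<in> carrier_mat (Suc n) (Suc n)" "T \<in> carrier_mat (Suc n) (Suc n)"
    unfolding S_def T_def by auto
  have SS: "S * S = 1\<^sub>m (Suc n)" and TT: "T * T = 1\<^sub>m (Suc n)"
    unfolding S_def T_def using rs by (auto intro: swaprows_mat_inv)
  have swr: "swaprows 0 r M \<in> carrier_mat (Suc n) (Suc n)" using Suc.prems by simp
  have "N = S * M * T" unfolding N_def S_def T_def
    using swapcols_mat[OF swr, of 0 s] swaprows_mat[OF Suc.prems, of 0 r] rs by simp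
  hence "S * N * T = (S * S) * M * (T * T)"
    using ST Suc.prems by (simp add: assoc_mult_mat[of _ "Suc n" "Suc n" _ "Suc n" _ "Suc n"])
  hence MN: "M = S * N * T" using SS TT Suc.prems by simp
  define d where "d = N $$ (0, 0)"
  have dmin: "val d \<le> val (N $$ (i, j))" if "i < Suc n" "j < Suc n" for i j
    using p(2) Suc.prems rs that unfolding d_def N_def I_def by auto
  define B C where "B = Matrix.mat 1 n (\<lambda>(i, j). N $$ (0, Suc j) / d)"
    and "C = Matrix.mat n 1 (\<lambda>(i, j). N $$ (Suc i, 0) / d)"
  \<comment> \<open>\<open>R\<close> is the Schur complement of the pivot \<open>d\<close>.\<close>
  define R where "R = Matrix.mat n n (\<lambda>(i, j). N $$ (Suc i, Suc j) - N $$ (Suc i, 0) * (N $$ (0, Suc j) / d))"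
  have BC: "B \<in> carrier_mat 1 n" "C \<in> carrier_mat n 1" "R \<in> carrier_mat n n"
    unfolding B_def C_def R_def by auto
  have intBC: "elements_mat B \<subseteq> integers_of val" "elements_mat C \<subseteq> integers_of val"
  proof -
    show "elements_mat B \<subseteq> integers_of val"
    proof
      fix x assume "x \<in> elements_mat B"
      then obtain j where "j < n" "x = N $$ (0, Suc j) / d" using elements_matD[of x B] by (auto simp: B_def)
      thus "x \<in> integers_of val" using dmin by (simp add: integers_of_def val_divide_ge_0)
    qed
    show "elements_mat C \<subseteq> integers_of val"
    proof
      fix x assume "x \<in> elements_mat C"
      then obtain j where "j < n" "x = N $$ (Suc j, 0) / d" using elements_matD[of x C] by (auto simp: C_def)
      thus "x \<in> integers_of val" using dmin by (simp add: integers_of_def val_divide_ge_0)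
    qed
  qed
  have Rge: "val d \<le> val (R $$ (i, j))" if ij: "i < n" "j < n" for i j
  proof -
    have "val d + 0 \<le> val (N $$ (Suc i, 0)) + val (N $$ (0, Suc j) / d)"
      using dmin ij by (intro add_mono val_divide_ge_0) auto
    hence "val d \<le> val (- (N $$ (Suc i, 0) * (N $$ (0, Suc j) / d)))"
      by (simp add: val_mult del: times_divide_eq_right)
    moreover have "val d \<le> val (N $$ (Suc i, Suc j))" using dmin ij by auto
    ultimately show ?thesis
      using val_add[of "N $$ (Suc i, Suc j)" "- (N $$ (Suc i, 0) * (N $$ (0, Suc j) / d))"] ij
      unfolding R_def by (simp add: min_def split: if_splits)
  qed
  \<comment> \<open>A zero pivot forces \<open>N = 0\<close> by minimality. Quotients by
    \<open>d\<close> are then 0 by the convention for division, and the block factorization of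
    \<open>N\<close> still holds.\<close>
  have dz: "d = 0 \<Longrightarrow> N $$ (i, j) = 0" if "i < Suc n" "j < Suc n" for i j
    using dmin[OF that] by (simp add: val_eq_infinity_iff)
  let ?L = "four_block_mat (1\<^sub>m 1) (0\<^sub>m 1 n) C (1\<^sub>m n)"
  let ?H = "four_block_mat (1\<^sub>m 1) B (0\<^sub>m n 1) (1\<^sub>m n)"
  let ?E = "four_block_mat (d \<cdot>\<^sub>m 1\<^sub>m 1) (0\<^sub>m 1 n) (0\<^sub>m n 1) R"
  obtain U D V where smith: "smith_decomposition val R U D V" using Suc.IH[OF BC(3)] by blast
  hence U: "unimodular val n U" and V: "unimodular val n V" and D: "D \<in> carrier_mat n n" "diagonal_mat D"
    and sorted: "\<And>i j. i \<le> j \<Longrightarrow> j < n \<Longrightarrow> val (D $$ (i, i)) \<le> val (D $$ (j, j))"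
    and RUDV: "R = U * D * V"
    using BC(3) unfolding smith_decomposition_def Let_def by auto
  obtain U' where U': "U \<in> carrier_mat n n" "U' \<in> carrier_mat n n" "elements_mat U' \<subseteq> integers_of val" "U' * U = 1\<^sub>m n"
    using U by (rule unimodularE)
  obtain V' where V': "V \<in> carrier_mat n n" "V' \<in> carrier_mat n n" "elements_mat V' \<subseteq> integers_of val" "V * V' = 1\<^sub>m n"
    using V by (rule unimodularE)
  have "U' * R * V' = (U' * U) * D * (V * V')"
    unfolding RUDV using U'(1,2) V'(1,2) D(1) by (simp add: assoc_mult_mat[of _ n n _ n _ n])
  also have "\<dots> = D" unfolding U'(4) V'(4) using D by simp
  finally have DR: "D = U' * R * V'" ..
  \<comment> \<open>The diagonal entries of \<open>D\<close> are integral combinations of entries of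
    \<open>R\<close>, so the pivot may stand first without breaking the order.\<close>
  have Dge: "val d \<le> val (D $$ (i, i))" if i: "i < n" for i
    unfolding DR
  proof (rule val_mult_mat_ge[of _ n n _ n])
    fix k assume k: "k < n"
    have "val d \<le> val ((U' * R) $$ (i, k))"
    proof (rule val_mult_mat_ge[of _ n n _ n])
      fix l assume l: "l < n"
      have "0 + val d \<le> val (U' $$ (i, l)) + val (R $$ (l, k))"
        using U' Rge i k l by (intro add_mono) (auto simp: integers_of_def)
      thus "val d \<le> val (U' $$ (i, l)) + val (R $$ (l, k))" by simp
    qed (use U' BC i k in auto)
    hence "val d + 0 \<le> val ((U' * R) $$ (i, k)) + val (V' $$ (k, i))"
      using V' i k by (intro add_mono) (auto simp: integers_of_def)
    thus "val d \<le> val ((U' * R) $$ (i, k)) + val (V' $$ (k, i))" by simp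
  qed (use U' V' BC i in auto)
  let ?U = "four_block_mat (1\<^sub>m 1) (0\<^sub>m 1 n) (0\<^sub>m n 1) U"
  let ?V = "four_block_mat (1\<^sub>m 1) (0\<^sub>m 1 n) (0\<^sub>m n 1) V"
  let ?D = "four_block_mat (d \<cdot>\<^sub>m 1\<^sub>m 1) (0\<^sub>m 1 n) (0\<^sub>m n 1) D"
  have carr: "?L \<in> carrier_mat (Suc n) (Suc n)" "?H \<in> carrier_mat (Suc n) (Suc n)"
    "?E \<in> carrier_mat (Suc n) (Suc n)" "?U \<in> carrier_mat (Suc n) (Suc n)"
    "?V \<in> carrier_mat (Suc n) (Suc n)" "?D \<in> carrier_mat (Suc n) (Suc n)"
    using BC U' V' D by auto
  have "?L * ?E = four_block_mat (d \<cdot>\<^sub>m 1\<^sub>m 1) (0\<^sub>m 1 n) (d \<cdot>\<^sub>m C) R"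
    using BC by (subst mult_four_block_mat[of _ 1 1 _ n _ n _ _ 1 _ n]) auto
  also have "\<dots> * ?H = four_block_mat (d \<cdot>\<^sub>m 1\<^sub>m 1) (d \<cdot>\<^sub>m B) (d \<cdot>\<^sub>m C) (d \<cdot>\<^sub>m C * B + R)"
    using BC mult_smult_assoc_mat[of "1\<^sub>m 1" 1 1 B n d] by (subst mult_four_block_mat[of _ 1 1 _ n _ n _ _ 1 _ n]) auto
  also have "\<dots> = N"
  proof (rule eq_matI)
    fix i j assume "i < dim_row N" "j < dim_col N"
    hence ij: "i < Suc n" "j < Suc n" using N by auto
    show "four_block_mat (d \<cdot>\<^sub>m 1\<^sub>m 1) (d \<cdot>\<^sub>m B) (d \<cdot>\<^sub>m C) (d \<cdot>\<^sub>m C * B + R) $$ (i, j) = N $$ (i, j)"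
      using ij dz[OF ij] BC dz[of i 0]
      by (cases i; cases j) (auto simp: B_def C_def R_def d_def[symmetric] scalar_prod_def)
  qed (use N BC in auto)
  finally have NLEH: "N = ?L * ?E * ?H" ..
  have "?U * ?D = four_block_mat (d \<cdot>\<^sub>m 1\<^sub>m 1) (0\<^sub>m 1 n) (0\<^sub>m n 1) (U * D)"
    using U' D by (subst mult_four_block_mat[of _ 1 1 _ n _ n _ _ 1 _ n]) auto
  also have "\<dots> * ?V = ?E"
    unfolding RUDV using U' V' D by (subst mult_four_block_mat[of _ 1 1 _ n _ n _ _ 1 _ n]) auto
  finally have E: "?E = ?U * ?D * ?V" ..
  have "M = (S * ?L * ?U) * ?D * (?V * ?H * T)"
    unfolding MN NLEH E using carr ST by (simp add: assoc_mult_mat[of _ "Suc n" "Suc n" _ "Suc n" _ "Suc n"])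
  moreover have "unimodular val (Suc n) (S * ?L * ?U)"
    unfolding S_def using rs
    by (intro unimodular_mult unimodular_swaprows_mat unimodular_lower[OF BC(2) intBC(2)] unimodular_block[OF U]) auto
  moreover have "unimodular val (Suc n) (?V * ?H * T)"
    unfolding T_def using rs
    by (intro unimodular_mult unimodular_swaprows_mat unimodular_upper[OF BC(1) intBC(1)] unimodular_block[OF V]) auto
  moreover have "diagonal_mat ?D" using D unfolding diagonal_mat_def by auto
  moreover have "val (?D $$ (i, i)) \<le> val (?D $$ (j, j))" if "i \<le> j" "j < Suc n" for i j
    using that D sorted[of "i - 1" "j - 1"] Dge[of "j - 1"] by auto
  ultimately have "smith_decomposition val M (S * ?L * ?U) ?D (?V * ?H * T)"
    using Suc.prems carr unfolding smith_decomposition_def Let_def by auto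
  thus ?case by blast
qed

end

section \<open>Zeros on the Smith diagonal and Jordan blocks\<close>

text \<open>The vectors \<open>W e\<^sub>i\<close> and \<open>W e\<^sub>j\<close> lie in the kernel.
  If the kernel had dimension at most one, both would be multiples of a single \<open>b\<close>;
  applying \<open>V\<close> would then make \<open>e\<^sub>i\<close> and \<open>e\<^sub>j\<close>
  multiples of the same vector.\<close>

lemma kernel_dim_diagonal_two_zeros:
  fixes D :: "'b :: field mat"
  assumes U: "U \<in> carrier_mat n n" and D: "D \<in> carrier_mat n n" "diagonal_mat D"
    and V: "V \<in> carrier_mat n n" and W: "W \<in> carrier_mat n n" "V * W = 1\<^sub>m n"
    and ij: "i < n" "j < n" "i \<noteq> j" and zero: "D $$ (i, i) = 0" "D $$ (j, j) = 0"
  shows "1 < kernel_dim (U * D * V)"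
proof (rule ccontr)
  define A where "A = U * D * V"
  assume "\<not> 1 < kernel_dim (U * D * V)"
  hence le: "kernel_dim A \<le> 1" unfolding A_def by simp
  have A: "A \<in> carrier_mat n n" using U D V unfolding A_def by auto
  interpret K: kernel n n A by unfold_locales (rule A)
  obtain B where B: "finite B" "K.basis B" using kernel_basis_exists[OF A] by blast
  have "card B \<le> 1" using K.Ker.dim_basis[OF B] le by simp
  then obtain b where b: "B \<subseteq> {b}" using B(1) by (cases "B = {}") (auto simp: card_le_Suc0_iff_eq)
  have Bk: "B \<subseteq> mat_kernel A" and spanB: "K.span B = mat_kernel A"
    using B(2) unfolding K.Ker.basis_def by auto
  have Bc: "B \<subseteq> carrier_vec n" using Bk mat_kernel_carrier[OF A] by auto
  have multiple: "\<exists>c. \<forall>l < n. x $ l = c * b $ l" if x: "x \<in> mat_kernel A" for x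
  proof -
    have "x \<in> K.NC.span B" using x spanB K.span_same[OF Bk] by simp
    then obtain a S where S: "finite S" "S \<subseteq> B" "x = K.NC.lincomb a S"
      unfolding K.NC.span_def by auto
    have "x $ l = (\<Sum>y\<in>S. a y * y $ l)" if "l < n" for l
      unfolding S(3) using that S Bc by (intro K.NC.lincomb_index) auto
    moreover have "S = {} \<or> S = {b}" using S(2) b by auto
    ultimately show ?thesis by (auto intro: exI[of _ 0])
  qed
  have ker: "W *\<^sub>v unit_vec n k \<in> mat_kernel A" and Vv: "V *\<^sub>v (W *\<^sub>v unit_vec n k) = unit_vec n k"
    if k: "k < n" "D $$ (k, k) = 0" for k
  proof -
    have "V *\<^sub>v (W *\<^sub>v unit_vec n k) = V * W *\<^sub>v unit_vec n k"
      using V W by (intro assoc_mult_mat_vec[symmetric]) auto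
    thus Vv: "V *\<^sub>v (W *\<^sub>v unit_vec n k) = unit_vec n k" using W by simp
    have D0: "D *\<^sub>v unit_vec n k = 0\<^sub>v n"
    proof (rule eq_vecI)
      fix l assume "l < dim_vec (0\<^sub>v n :: 'b Matrix.vec)"
      thus "(D *\<^sub>v unit_vec n k) $ l = 0\<^sub>v n $ l"
        using D k unfolding diagonal_mat_def by (cases "l = k") auto
    qed (use D in auto)
    have "A *\<^sub>v (W *\<^sub>v unit_vec n k) = U * D *\<^sub>v (V *\<^sub>v (W *\<^sub>v unit_vec n k))"
      unfolding A_def using U D V W by (intro assoc_mult_mat_vec) auto
    also have "\<dots> = U *\<^sub>v (D *\<^sub>v unit_vec n k)"
      unfolding Vv using U D by (intro assoc_mult_mat_vec) auto
    also have "\<dots> = 0\<^sub>v n" unfolding D0 using U by (intro eq_vecI) auto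
    finally show "W *\<^sub>v unit_vec n k \<in> mat_kernel A" using A W by (intro mat_kernelI) auto
  qed
  obtain c where c: "\<forall>l < n. (W *\<^sub>v unit_vec n i) $ l = c * b $ l" using multiple[OF ker[OF ij(1) zero(1)]] by blast
  obtain d where d: "\<forall>l < n. (W *\<^sub>v unit_vec n j) $ l = d * b $ l" using multiple[OF ker[OF ij(2) zero(2)]] by blast
  \<comment> \<open>The coordinates of \<open>V b\<close>, written as sums because \<open>b\<close>
    is an arbitrary vector, possibly of another length, when the basis is empty.\<close>
  define e where "e r = (\<Sum>l = 0..<n. V $$ (r, l) * b $ l)" for r
  have comp: "unit_vec n k $ r = x * e r"
    if "k < n" "D $$ (k, k) = 0" "r < n" "\<forall>l < n. (W *\<^sub>v unit_vec n k) $ l = x * b $ l" for k r x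
  proof -
    have "unit_vec n k $ r = (V *\<^sub>v (W *\<^sub>v unit_vec n k)) $ r" using Vv[OF that(1,2)] by simp
    also have "\<dots> = (\<Sum>l = 0..<n. V $$ (r, l) * (W *\<^sub>v unit_vec n k) $ l)"
    proof -
      have "(V *\<^sub>v w) $ r = (\<Sum>l = 0..<n. V $$ (r, l) * w $ l)" if "w \<in> carrier_vec n" for w
        using V that \<open>r < n\<close> by (simp add: scalar_prod_def)
      thus ?thesis using W by simp
    qed
    also have "\<dots> = (\<Sum>l = 0..<n. V $$ (r, l) * (x * b $ l))" using that(4) by (intro sum.cong) auto
    finally show ?thesis by (simp add: e_def sum_distrib_left mult.left_commute)
  qed
  have "1 = c * e i" "0 = d * e i" "1 = d * e j"
    using comp[OF ij(1) zero(1) ij(1) c] comp[OF ij(2) zero(2) ij(1) d] comp[OF ij(2) zero(2) ij(2) d] ij by auto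
  thus False by auto
qed

text \<open>Each Jordan block with eigenvalue 0 contributes at most one dimension to the kernel, and
  distinct eigenvalues allow only one such block.\<close>

lemma kernel_dim_distinct_jordan_nf:
  assumes A: "A \<in> carrier_mat n n" and J: "jordan_nf A n_as" "distinct (map snd n_as)"
  shows "kernel_dim A \<le> 1"
proof -
  have "char_matrix A 0 = A" using A unfolding char_matrix_def by (intro eq_matI) auto
  hence "char_matrix A 0 ^\<^sub>m 1 = A" using A by simp
  hence "kernel_dim A = (\<Sum>k\<leftarrow>map fst (filter (\<lambda>(k, e). e = 0) n_as). min 1 k)"
    using dim_gen_eigenspace[OF J(1), of 0 1] unfolding dim_gen_eigenspace_def by simp
  also have "\<dots> \<le> length (filter (\<lambda>(k, e). e = 0) n_as)"
  proof -
    have "(\<Sum>k\<leftarrow>ks. min 1 k) \<le> length ks" for ks :: "nat list" by (induction ks) auto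
    from this[of "map fst (filter (\<lambda>(k, e). e = 0) n_as)"] show ?thesis by simp
  qed
  also have "\<dots> \<le> 1" using J(2)
  proof (induction n_as)
    case (Cons p n_as)
    have "filter (\<lambda>(k, e). e = 0) n_as = []" if "snd p = 0"
      using Cons.prems that by (auto simp: filter_empty_conv image_iff)
    thus ?case using Cons by (auto split: prod.splits)
  qed simp
  finally show ?thesis .
qed

text \<open>The Jordan form lives over the algebraic closure, so the factorization is transported
  along \<open>to_ac\<close>, which preserves zeros, diagonal shape and the inverse of
  \<open>V\<close>.\<close>

lemma distinct_jordan_eigenvalues_diagonal:
  assumes "distinct_jordan_eigenvalues (U * D * V)"
    and U: "U \<in> carrier_mat n n" and D: "D \<in> carrier_mat n n" "diagonal_mat D"
    and V: "V \<in> carrier_mat n n" and W: "W \<in> carrier_mat n n" "V * W = 1\<^sub>m n"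
    and ij: "i < n" "j < n" "i \<noteq> j" and zero: "D $$ (i, i) = 0"
  shows "D $$ (j, j) \<noteq> 0"
proof
  assume zero': "D $$ (j, j) = 0"
  interpret comm_ring_hom "to_ac :: 'a \<Rightarrow> 'a alg_closure" by unfold_locales auto
  let ?h = "map_mat (to_ac :: 'a \<Rightarrow> 'a alg_closure)"
  have eq: "?h (U * D * V) = ?h U * ?h D * ?h V"
    using U D V by (simp add: mat_hom_mult[of _ n n _ n])
  have "1 < kernel_dim (?h U * ?h D * ?h V)"
  proof (rule kernel_dim_diagonal_two_zeros[of _ n _ _ "?h W"])
    show "?h V * ?h W = 1\<^sub>m n" using V W mat_hom_mult[of V n n W n] mat_hom_one[of n] by simp
    show "diagonal_mat (?h D)" using D unfolding diagonal_mat_def by auto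
  qed (use U D V W ij zero zero' in auto)
  moreover obtain n_as where "jordan_nf (?h (U * D * V)) n_as" "distinct (map snd n_as)"
    using assms(1) unfolding distinct_jordan_eigenvalues_def by blast
  ultimately show False
    using kernel_dim_distinct_jordan_nf[of "?h (U * D * V)" n n_as] U D V unfolding eq by simp
qed

section \<open>The comatrix of the characteristic matrix\<close>

text \<open>In place of inverses over the domain: the product \<open>R\<close> of the adjugates
  satisfies \<open>A B R = det (A B) I\<close>. Multiplying by \<open>adj_mat (A * B)\<close> on the
  left leaves the same nonzero scalar on both sides, and it cancels entrywise.\<close>

lemma adj_mat_mult:
  fixes A B :: "'a :: idom mat"
  assumes A: "A \<in> carrier_mat n n" and B: "B \<in> carrier_mat n n"
    and det: "det A \<noteq> 0" "det B \<noteq> 0"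
  shows "adj_mat (A * B) = adj_mat B * adj_mat A"
proof -
  define R where "R = adj_mat B * adj_mat A"
  have AB: "A * B \<in> carrier_mat n n" using A B by auto
  note adj = adj_mat[OF A] adj_mat[OF B] adj_mat[OF AB]
  have R: "R \<in> carrier_mat n n" unfolding R_def using adj by auto
  have "(A * B) * R = A * (B * adj_mat B) * adj_mat A"
    unfolding R_def using A B adj(1,4) by (simp add: assoc_mult_mat[of _ n n _ n _ n])
  also have "\<dots> = det B \<cdot>\<^sub>m (A * adj_mat A)"
    unfolding adj(5) using A adj(1)
    by (simp add: mult_smult_distrib[of _ n n _ n] mult_smult_assoc_mat[of _ n n _ n] del: assoc_mult_mat)
  also have "\<dots> = det (A * B) \<cdot>\<^sub>m 1\<^sub>m n"
    unfolding adj(2) det_mult[OF A B] by (intro eq_matI) auto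
  finally have ABR: "(A * B) * R = det (A * B) \<cdot>\<^sub>m 1\<^sub>m n" .
  have "det (A * B) \<cdot>\<^sub>m R = adj_mat (A * B) * (A * B) * R"
    unfolding adj(9) using R by (simp add: mult_smult_assoc_mat[of _ n n _ n])
  also have "\<dots> = adj_mat (A * B) * ((A * B) * R)" by (rule assoc_mult_mat[OF adj(7) AB R])
  also have "\<dots> = det (A * B) \<cdot>\<^sub>m adj_mat (A * B)"
    unfolding ABR using adj(7) by (simp add: mult_smult_distrib[of _ n n _ n])
  finally have eq: "det (A * B) \<cdot>\<^sub>m R = det (A * B) \<cdot>\<^sub>m adj_mat (A * B)" .
  have "det (A * B) \<noteq> 0" using det det_mult[OF A B] by simp
  thus ?thesis unfolding R_def[symmetric]
  proof (intro eq_matI)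
    fix i j assume "i < dim_row R" "j < dim_col R"
    thus "adj_mat (A * B) $$ (i, j) = R $$ (i, j)"
      using arg_cong[OF eq, of "\<lambda>A. A $$ (i, j)"] R adj(7) \<open>det (A * B) \<noteq> 0\<close> by auto
  qed (use R adj(7) in auto)
qed

lemma adj_mat_const_poly:
  fixes A :: "'a :: comm_ring_1 mat"
  assumes A: "A \<in> carrier_mat n n"
  shows "adj_mat (map_mat (\<lambda>x. [:x:]) A) = map_mat (\<lambda>x. [:x:]) (adj_mat A)"
proof (rule eq_matI)
  interpret comm_ring_hom "\<lambda>x :: 'a. [:x:]" by (rule hom_const_poly)
  fix i j assume "i < dim_row (map_mat (\<lambda>x. [:x:]) (adj_mat A))" "j < dim_col (map_mat (\<lambda>x. [:x:]) (adj_mat A))"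
  hence ij: "i < n" "j < n" using adj_mat(1)[OF A] by auto
  have "mat_delete (map_mat (\<lambda>x. [:x:]) A) j i = map_mat (\<lambda>x. [:x:]) (mat_delete A j i)"
    using A by (intro eq_matI) (auto simp: mat_delete_def)
  hence "cofactor (map_mat (\<lambda>x. [:x:]) A) j i = [:cofactor A j i:]"
    unfolding cofactor_def det_const_poly by (simp add: det_const_poly hom_mult hom_power hom_uminus flip: one_pCons)
  thus "adj_mat (map_mat (\<lambda>x. [:x:]) A) $$ (i, j) = map_mat (\<lambda>x. [:x:]) (adj_mat A) $$ (i, j)"
    using A ij by (simp add: adj_mat_def)
qed (use A in \<open>auto simp: adj_mat_def\<close>)

context complete_dvf
begin

lemma val_adj_mat_ge_0:
  assumes A: "A \<in> carrier_mat n n" and int: "elements_mat A \<subseteq> integers_of val" and ij: "i < n" "j < n"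
  shows "0 \<le> val (adj_mat A $$ (i, j))"
proof -
  have "0 \<le> val (det (mat_delete A j i))"
  proof (rule val_det_ge_0[of _ "n - 1"])
    fix k l assume "k < n - 1" "l < n - 1"
    thus "0 \<le> val (mat_delete A j i $$ (k, l))"
      using A integral_index[OF A int] by (auto simp: mat_delete_def)
  qed (use A in \<open>auto simp: mat_delete_def\<close>)
  thus ?thesis using A ij by (simp add: adj_mat_def cofactor_def)
qed

lemma integral_const_mult_coeff_ge:
  assumes A: "A \<in> carrier_mat n n" and int: "\<And>i j. i < n \<Longrightarrow> j < n \<Longrightarrow> 0 \<le> val (A $$ (i, j))"
    and B: "B \<in> carrier_mat n n" and ge: "\<And>i j. i < n \<Longrightarrow> j < n \<Longrightarrow> c \<le> val (coeff (B $$ (i, j)) k)"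
    and ij: "i < n" "j < n"
  shows "c \<le> val (coeff ((map_mat (\<lambda>x. [:x:]) A * B) $$ (i, j)) k)"
    and "c \<le> val (coeff ((B * map_mat (\<lambda>x. [:x:]) A) $$ (i, j)) k)"
proof -
  have mult: "c \<le> val (x * y)" if "0 \<le> val x" "c \<le> val y" for x y
    using add_mono[OF that] by (simp add: val_mult)
  have "(map_mat (\<lambda>x. [:x:]) A * B) $$ (i, j) = (\<Sum>l = 0..<n. smult (A $$ (i, l)) (B $$ (l, j)))"
    using A B ij by (simp add: times_mat_def scalar_prod_def)
  thus "c \<le> val (coeff ((map_mat (\<lambda>x. [:x:]) A * B) $$ (i, j)) k)"
    using int ge ij by (auto simp: coeff_sum intro!: val_sum_ge mult)
  have "(B * map_mat (\<lambda>x. [:x:]) A) $$ (i, j) = (\<Sum>l = 0..<n. smult (A $$ (l, j)) (B $$ (i, l)))"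
    using A B ij by (simp add: times_mat_def scalar_prod_def mult.commute)
  thus "c \<le> val (coeff ((B * map_mat (\<lambda>x. [:x:]) A) $$ (i, j)) k)"
    using int ge ij by (auto simp: coeff_sum intro!: val_sum_ge mult)
qed

end

locale smith_decomposed = complete_dvf val for val :: "'a :: field \<Rightarrow> ereal" +
  fixes M U D V :: "'a mat" and n :: nat
  assumes M: "M \<in> carrier_mat n n" and n: "0 < n" and smith: "smith_decomposition val M U D V"
begin

text \<open>For the chosen Smith diagonal this is
  \<open>\<sigma>\<^sub>1 + ... + \<sigma>\<^sub>m\<close>, the height of the Hodge point at
  abscissa \<open>n - m\<close>.\<close>

definition partial_sum :: "nat \<Rightarrow> ereal" where
  "partial_sum m = (\<Sum>r<m. val (D $$ (r, r)))"

lemma D: "D \<in> carrier_mat n n" "diagonal_mat D"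
  and uniU: "unimodular val n U" and uniV: "unimodular val n V"
  and sorted: "i \<le> j \<Longrightarrow> j < n \<Longrightarrow> val (D $$ (i, i)) \<le> val (D $$ (j, j))"
  and MUDV: "M = U * D * V"
  using smith M unfolding smith_decomposition_def Let_def by auto

lemma partial_sum_eq: "partial_sum m = val (\<Prod>r<m. D $$ (r, r))"
  by (simp add: partial_sum_def val_prod)

text \<open>\<open>Q\<close> is \<open>X W - D\<close> with \<open>W = U' V'\<close>, where
  \<open>U'\<close> and \<open>V'\<close> invert \<open>U\<close> and \<open>V\<close>. Both
  factorizations are recorded: the one of \<open>X - M\<close> pushes bounds from
  \<open>adj_mat Q\<close> to the comatrix, the one of \<open>Q\<close> pulls them back and so shows
  that a bound is attained.\<close>

lemma reduced_matrix:
  obtains Q U' V' where "Q \<in> carrier_mat n n"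
    and "unimodular val n U'" and "unimodular val n V'"
    and "Q = map_mat (\<lambda>x. [:x:]) U' * char_poly_matrix M * map_mat (\<lambda>x. [:x:]) V'"
    and "char_poly_matrix M = map_mat (\<lambda>x. [:x:]) U * Q * map_mat (\<lambda>x. [:x:]) V"
    and "\<And>i j. i < n \<Longrightarrow> j < n \<Longrightarrow> \<exists>w. Q $$ (i, j) = [:- D $$ (i, j), w:] \<and> 0 \<le> val w"
proof -
  interpret const: comm_ring_hom "\<lambda>x :: 'a. [:x:]" by (rule hom_const_poly)
  let ?c = "map_mat (\<lambda>x :: 'a. [:x:])"
  obtain U' where U: "U \<in> carrier_mat n n" "elements_mat U \<subseteq> integers_of val"
    and U': "U' \<in> carrier_mat n n" "elements_mat U' \<subseteq> integers_of val" "U * U' = 1\<^sub>m n" "U' * U = 1\<^sub>m n"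
    using uniU by (rule unimodularE)
  obtain V' where V: "V \<in> carrier_mat n n" "elements_mat V \<subseteq> integers_of val"
    and V': "V' \<in> carrier_mat n n" "elements_mat V' \<subseteq> integers_of val" "V * V' = 1\<^sub>m n" "V' * V = 1\<^sub>m n"
    using uniV by (rule unimodularE)
  note X = char_poly_matrix_closed[OF M]
  define Q where "Q = ?c U' * (char_poly_matrix M * ?c V')"
  have XV: "char_poly_matrix M * ?c V' \<in> carrier_mat n n" using X V' by (intro mult_carrier_mat[of _ n n]) auto
  have Q: "Q \<in> carrier_mat n n" unfolding Q_def by (rule mult_carrier_mat[OF _ XV]) (use U' in simp)
  have Q': "Q = ?c U' * char_poly_matrix M * ?c V'"
    unfolding Q_def using X U' V' by (simp add: assoc_mult_mat[of _ n n _ n _ n])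
  have "?c U * ?c U' = 1\<^sub>m n" "?c V' * ?c V = 1\<^sub>m n"
    using U U' V V' const.mat_hom_mult[of U n n U' n] const.mat_hom_mult[of V' n n V n] const.mat_hom_one[of n] by simp_all
  note inv = this
  have "?c U * Q * ?c V = (?c U * ?c U') * char_poly_matrix M * (?c V' * ?c V)"
    unfolding Q' using U(1) U'(1) V(1) V'(1) X by (simp add: assoc_mult_mat[of _ n n _ n _ n])
  also have "\<dots> = char_poly_matrix M" unfolding inv using X by simp
  finally have XQ: "char_poly_matrix M = ?c U * Q * ?c V" ..
  have "U' * (M * V') = (U' * U) * D * (V * V')"
    unfolding MUDV using U(1) U'(1) V(1) V'(1) D(1) by (simp add: assoc_mult_mat[of _ n n _ n _ n])
  also have "\<dots> = D" unfolding U'(4) V'(3) using D by simp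
  finally have DM: "U' * (M * V') = D" .
  have entryX: "(char_poly_matrix M * ?c V') $$ (i, j) = [:- (M * V') $$ (i, j), V' $$ (i, j):]"
    if ij: "i < n" "j < n" for i j
  proof -
    have "(\<Sum>l = 0..<n. smult (M $$ (i, l)) (?c V' $$ (l, j))) = [:(M * V') $$ (i, j):]"
      using M V' ij by (intro poly_eqI) (simp add: times_mat_def scalar_prod_def coeff_sum coeff_pCons split: nat.split)
    thus ?thesis using char_poly_matrix_mult_index[OF M, of "?c V'" i j] V' ij by simp
  qed
  have "\<exists>w. Q $$ (i, j) = [:- D $$ (i, j), w:] \<and> 0 \<le> val w" if ij: "i < n" "j < n" for i j
  proof -
    have UV: "elements_mat (U' * V') \<subseteq> integers_of val" "U' * V' \<in> carrier_mat n n"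
      using integral_mult[OF U'(1,2) V'(1,2)] U'(1) V'(1) by auto
    have "Q $$ (i, j) = (\<Sum>l = 0..<n. smult (U' $$ (i, l)) [:- (M * V') $$ (l, j), V' $$ (l, j):])"
      using U' XV ij entryX unfolding Q_def
      by (subst index_mult_mat_sum[of _ n n _ n]) (auto intro!: sum.cong simp del: index_mult_mat(1))
    also have "\<dots> = [:- (U' * (M * V')) $$ (i, j), (U' * V') $$ (i, j):]"
      using M U' V' ij
      by (intro poly_eqI) (simp add: times_mat_def scalar_prod_def coeff_sum coeff_pCons sum_negf split: nat.split)
    finally have "Q $$ (i, j) = [:- D $$ (i, j), (U' * V') $$ (i, j):]" unfolding DM .
    moreover have "(U' * V') $$ (i, j) \<in> elements_mat (U' * V')" using UV(2) ij by (intro elements_matI) auto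
    ultimately show ?thesis using UV(1) by (auto simp: integers_of_def)
  qed
  thus thesis using that[OF Q _ _ Q' XQ] unimodularI[OF U'(1,2) U U'(4)] unimodularI[OF V'(1,2) V V'(4)] by blast
qed

lemma unimodular_det_const:
  assumes "unimodular val n A"
  shows "det (map_mat (\<lambda>x. [:x:]) A) \<noteq> 0"
proof -
  obtain W where W: "A \<in> carrier_mat n n" "W \<in> carrier_mat n n" "A * W = 1\<^sub>m n"
    using assms by (rule unimodularE)
  have "det A * det W = 1" using det_mult[OF W(1,2)] W(3) by simp
  thus ?thesis by (auto simp: det_const_poly)
qed

text \<open>The adjugate reverses products, and the adjugates of \<open>S\<close> and
  \<open>T\<close> are again constant and integral, so multiplying by them preserves a common lower
  bound on the coefficients of index \<open>k\<close>.\<close>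

lemma coeff_unimodular_adj_ge:
  assumes B: "B \<in> carrier_mat n n" "det B \<noteq> 0" and uni: "unimodular val n S" "unimodular val n T"
    and A: "A = map_mat (\<lambda>x. [:x:]) S * B * map_mat (\<lambda>x. [:x:]) T"
    and ge: "\<And>i j. i < n \<Longrightarrow> j < n \<Longrightarrow> c \<le> val (coeff (adj_mat B $$ (i, j)) k)"
    and ij: "i < n" "j < n"
  shows "c \<le> val (coeff (adj_mat A $$ (i, j)) k)"
proof -
  let ?c = "map_mat (\<lambda>x :: 'a. [:x:])"
  have S: "S \<in> carrier_mat n n" "elements_mat S \<subseteq> integers_of val"
    and T: "T \<in> carrier_mat n n" "elements_mat T \<subseteq> integers_of val"
    using uni unfolding unimodular_def by auto
  have c: "?c S \<in> carrier_mat n n" "?c T \<in> carrier_mat n n" using S T by auto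
  have SB: "?c S * B \<in> carrier_mat n n" using c B by auto
  have det: "det (?c S) \<noteq> 0" "det (?c T) \<noteq> 0" using uni unimodular_det_const by blast+
  have "det (?c S * B) \<noteq> 0" using det_mult[OF c(1) B(1)] det B(2) by simp
  hence eq: "adj_mat A = ?c (adj_mat T) * (adj_mat B * ?c (adj_mat S))"
    unfolding A using adj_mat_mult[OF SB c(2)] adj_mat_mult[OF c(1) B(1)] det B(2)
    by (simp add: adj_mat_const_poly[OF S(1)] adj_mat_const_poly[OF T(1)])
  have adjB: "adj_mat B * ?c (adj_mat S) \<in> carrier_mat n n" using adj_mat(1)[OF B(1)] adj_mat(1)[OF S(1)] by auto
  show ?thesis unfolding eq
    by (intro integral_const_mult_coeff_ge(1)[OF adj_mat(1)[OF T(1)] val_adj_mat_ge_0[OF T] adjB _ ij]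
          integral_const_mult_coeff_ge(2)[OF adj_mat(1)[OF S(1)] val_adj_mat_ge_0[OF S] adj_mat(1)[OF B(1)] ge])
qed

lemma det_char_poly_matrix_nonzero: "det (char_poly_matrix M) \<noteq> 0"
  using degree_monic_char_poly[OF M] unfolding char_poly_def by auto

text \<open>In a minor of \<open>Q\<close> the constant terms are entries of \<open>D\<close> up to
  sign, hence 0 off the diagonal, and the coefficients of \<open>X\<close> are integral. The value
  \<open>\<infinity>\<close> expresses that the entries have degree less than
  \<open>n\<close>.\<close>

lemma coeff_Com_ge:
  assumes ij: "i < n" "j < n"
  shows "(if k < n then partial_sum (n - 1 - k) else \<infinity>) \<le> val (coeff (Com M $$ (i, j)) k)"
proof -
  obtain Q where Q: "Q \<in> carrier_mat n n"
    and X: "char_poly_matrix M = map_mat (\<lambda>x. [:x:]) U * Q * map_mat (\<lambda>x. [:x:]) V"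
    and entry: "\<And>i j. i < n \<Longrightarrow> j < n \<Longrightarrow> \<exists>w. Q $$ (i, j) = [:- D $$ (i, j), w:] \<and> 0 \<le> val w"
    using reduced_matrix by metis
  have c: "map_mat (\<lambda>x. [:x:]) U \<in> carrier_mat n n" "map_mat (\<lambda>x. [:x:]) V \<in> carrier_mat n n"
    using uniU uniV unfolding unimodular_def by auto
  have "map_mat (\<lambda>x. [:x:]) U * Q \<in> carrier_mat n n" using c Q by auto
  hence "det Q \<noteq> 0" using det_char_poly_matrix_nonzero det_mult[OF c(1) Q] det_mult[OF _ c(2)] unfolding X by auto
  have "(if k < n then partial_sum (n - 1 - k) else \<infinity>) \<le> val (coeff (adj_mat Q $$ (i, j)) k)"
    if ij: "i < n" "j < n" for i j
  proof -
    have "(if k \<le> n - 1 then \<Sum>r<n - 1 - k. val (D $$ (r, r)) else \<infinity>) \<le> val (coeff (det (mat_delete Q j i)) k)"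
    proof (rule coeff_det_linear)
      fix r s assume rs: "r < n - 1" "s < n - 1"
      \<comment> \<open>The position in \<open>Q\<close> of the entry \<open>(r, s)\<close> after
        row \<open>j\<close> and column \<open>i\<close> are deleted. Deletion can only move a row
        index up, so the order of the diagonal gives the bound by
        \<open>D $$ (r, r)\<close>.\<close>
      define r' s' where "r' = (if r < j then r else Suc r)" and "s' = (if s < i then s else Suc s)"
      have lt: "r' < n" "s' < n" "r \<le> r'" using rs by (auto simp: r'_def s'_def)
      have "mat_delete Q j i $$ (r, s) = Q $$ (r', s')"
        using Q rs by (simp add: mat_delete_def r'_def s'_def)
      then obtain w where w: "mat_delete Q j i $$ (r, s) = [:- D $$ (r', s'), w:]" "0 \<le> val w"
        using entry[OF lt(1,2)] by auto
      show "degree (mat_delete Q j i $$ (r, s)) \<le> 1" "0 \<le> val (coeff (mat_delete Q j i $$ (r, s)) 1)"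
        using w by auto
      have "val (D $$ (r, r)) \<le> val (D $$ (r', s'))"
        using sorted[OF lt(3,1)] D lt unfolding diagonal_mat_def by (cases "r' = s'") auto
      thus "val (D $$ (r, r)) \<le> val (coeff (mat_delete Q j i $$ (r, s)) 0)" using w by simp
    qed (use Q sorted in \<open>auto simp: mat_delete_def\<close>)
    moreover have "val (coeff (adj_mat Q $$ (i, j)) k) = val (coeff (det (mat_delete Q j i)) k)"
      using Q ij by (simp add: adj_mat_def cofactor_def coeff_minus_one_power_mult)
    ultimately show ?thesis using n by (auto simp: partial_sum_def split: if_splits)
  qed
  thus ?thesis unfolding Com_def
    using coeff_unimodular_adj_ge[OF Q \<open>det Q \<noteq> 0\<close> uniU uniV X] ij by blast
qed

text \<open>Deleting the last row and column of \<open>Q\<close> and setting \<open>X = 0\<close>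
  leaves \<open>- D\<close> without its largest entry, whose determinant has valuation
  \<open>partial_sum (n - 1)\<close>. The least valuation among the constant terms of the comatrix
  also bounds this minor from below.\<close>

lemma coeff_0_Com_attained:
  obtains i j where "i < n" "j < n" "val (coeff (Com M $$ (i, j)) 0) \<le> partial_sum (n - 1)"
proof -
  obtain Q U' V' where Q: "Q \<in> carrier_mat n n" and uni: "unimodular val n U'" "unimodular val n V'"
    and QX: "Q = map_mat (\<lambda>x. [:x:]) U' * char_poly_matrix M * map_mat (\<lambda>x. [:x:]) V'"
    and entry: "\<And>i j. i < n \<Longrightarrow> j < n \<Longrightarrow> \<exists>w. Q $$ (i, j) = [:- D $$ (i, j), w:] \<and> 0 \<le> val w"
    using reduced_matrix by metis
  define I where "I = (\<lambda>(i, j). val (coeff (Com M $$ (i, j)) 0)) ` ({0..<n} \<times> {0..<n})"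
  have I: "finite I" "I \<noteq> {}" using n unfolding I_def by auto
  have "Min I \<le> val (coeff (adj_mat Q $$ (n - 1, n - 1)) 0)"
  proof (rule coeff_unimodular_adj_ge[OF char_poly_matrix_closed[OF M] det_char_poly_matrix_nonzero uni QX])
    fix i j assume "i < n" "j < n"
    thus "Min I \<le> val (coeff (adj_mat (char_poly_matrix M) $$ (i, j)) 0)"
      unfolding Com_def[symmetric] by (intro Min_le I) (auto simp: I_def)
  qed (use n in auto)
  also have "\<dots> = val (coeff (det (mat_delete Q (n - 1) (n - 1))) 0)"
    using Q n by (simp add: adj_mat_def cofactor_def coeff_minus_one_power_mult)
  also have "coeff (det (mat_delete Q (n - 1) (n - 1))) 0 = poly (det (mat_delete Q (n - 1) (n - 1))) 0"
    by (simp add: poly_0_coeff_0)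
  also have "\<dots> = det (- mat_delete D (n - 1) (n - 1))"
  proof (rule poly_det_cong[of _ "n - 1"])
    fix i j assume ij: "i < n - 1" "j < n - 1"
    hence "i < n" "j < n" by auto
    from entry[OF this] show "poly (mat_delete Q (n - 1) (n - 1) $$ (i, j)) 0 = (- mat_delete D (n - 1) (n - 1)) $$ (i, j)"
      using ij Q D by (auto simp: mat_delete_def)
  qed (use Q D in \<open>auto simp: mat_delete_def\<close>)
  also have "\<dots> = (\<Prod>r<n - 1. - D $$ (r, r))"
  proof -
    have "upper_triangular (- mat_delete D (n - 1) (n - 1))"
      using D unfolding upper_triangular_def diagonal_mat_def by (auto simp: mat_delete_def)
    moreover have "- mat_delete D (n - 1) (n - 1) \<in> carrier_mat (n - 1) (n - 1)"
      using D by (auto simp: mat_delete_def)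
    ultimately have "det (- mat_delete D (n - 1) (n - 1)) = prod_list (diag_mat (- mat_delete D (n - 1) (n - 1)))"
      by (rule det_upper_triangular)
    also have "\<dots> = (\<Prod>r = 0..<n - 1. - D $$ (r, r))"
      unfolding prod_list_diag_prod using D by (intro prod.cong) (auto simp: mat_delete_def)
    finally show ?thesis by (simp add: atLeast0LessThan)
  qed
  also have "val (\<Prod>r<n - 1. - D $$ (r, r)) = partial_sum (n - 1)"
    by (simp add: val_prod partial_sum_def)
  finally have "Min I \<le> partial_sum (n - 1)" .
  moreover have "Min I \<in> I" using I by simp
  ultimately show thesis using that unfolding I_def by auto
qed

text \<open>The recursion at index \<open>n\<close>: the coefficient matrix of index
  \<open>n\<close> vanishes by degree and the characteristic polynomial is monic, so the one of
  index \<open>n - 1\<close> is the identity.\<close>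

lemma coeff_top_Com: "i < n \<Longrightarrow> j < n \<Longrightarrow> coeff (Com M $$ (i, j)) (n - 1) = (if i = j then 1 else 0)"
proof -
  assume ij: "i < n" "j < n"
  have "coeff (Com M $$ (k, l)) n = 0" if "k < n" "l < n" for k l
    using coeff_Com_ge[OF that, of n] by (simp add: val_eq_infinity_iff)
  hence "Com_coeff M n = 0\<^sub>m n n"
    using M by (intro eq_matI) (auto simp: Com_coeff_index carrier_matD[OF Com_coeff_carrier[OF M]])
  hence "Com_coeff M (n - 1) - 1 \<cdot>\<^sub>m 1\<^sub>m n = 0\<^sub>m n n"
    using mult_Com_coeff[OF M, of n] n M degree_monic_char_poly[OF M] by simp
  from arg_cong[OF this, of "\<lambda>A. A $$ (i, j)"] show ?thesis
    using ij Com_coeff_index[OF M ij] Com_coeff_carrier[OF M] by (auto split: if_splits)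
qed

end

section \<open>The polygons\<close>

definition coeff_points :: "('a :: field \<Rightarrow> ereal) \<Rightarrow> 'a poly \<Rightarrow> (real \<times> real) set" where
  "coeff_points val f = {(real k, y) |k y. val (coeff f k) = ereal y}"

lemma newton_polygon_eq: "newton_polygon val f = lower_convex_hull (coeff_points val f)"
  unfolding newton_polygon_def coeff_points_def ..

text \<open>Supplies the covering hypothesis of \<open>lower_convex_hull_leI\<close>, where the
  height of the point is immaterial.\<close>

lemma convex_hull_segment_covers:
  fixes S :: "(real \<times> real) set"
  assumes "(0, u) \<in> S" "(m, v) \<in> S" "0 \<le> x" "x \<le> m"
  shows "\<exists>y. (x, y) \<in> convex hull S"
proof (cases "m = 0")
  case True
  thus ?thesis using assms by (auto intro: hull_inc)
next
  case False
  hence m: "0 < m" using assms by linarith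
  have "(1 - x / m) *\<^sub>R (0, u) + (x / m) *\<^sub>R (m, v) \<in> convex hull S"
    using assms m by (intro convexD[OF convex_convex_hull]) (auto intro: hull_inc)
  moreover have "(1 - x / m) *\<^sub>R (0, u) + (x / m) *\<^sub>R (m, v) = (x, (1 - x / m) * u + x / m * v)"
    using m by simp
  ultimately show ?thesis by metis
qed

context complete_dvf
begin

lemma finite_coeff_points: "finite (coeff_points val f)"
proof (rule finite_subset)
  show "coeff_points val f \<subseteq> (\<lambda>k. (real k, real_of_ereal (val (coeff f k)))) ` {..degree f}"
  proof
    fix p assume "p \<in> coeff_points val f"
    then obtain k y where p: "p = (real k, y)" "val (coeff f k) = ereal y" unfolding coeff_points_def by auto
    hence "coeff f k \<noteq> 0" by auto
    hence "k \<le> degree f" by (rule le_degree)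
    thus "p \<in> (\<lambda>k. (real k, real_of_ereal (val (coeff f k)))) ` {..degree f}" using p by force
  qed
qed simp

lemma finite_Union_coeff_points: "finite (\<Union>f\<in>elements_mat A. coeff_points val f)"
  by (auto simp: elements_mat_def finite_coeff_points)

lemma PP_eq: "PP val M = lower_convex_hull (\<Union>f\<in>elements_mat (Com M). coeff_points val f)"
  unfolding PP_def newton_polygon_eq
  by (rule lower_convex_hull_Union) (rule finite_Union_coeff_points)

text \<open>Write \<open>a\<^sub>k\<close> for the coefficients of the characteristic polynomial and \<open>C\<^sub>k\<close> for those of the
  comatrix, and choose \<open>k\<close> with \<open>val a\<^sub>k - a k\<close> minimal. If \<open>k > 0\<close> and the point of \<open>a\<^sub>k\<close> were below
  the line shifted by one, then \<open>M C\<^sub>k = C\<^sub>k\<^sub>-\<^sub>1 - a\<^sub>k\<close> would be a perturbation of a scalar, and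
  \<open>coeff_char_poly_ge\<close> would make index \<open>0\<close> strictly better than \<open>k\<close>. If \<open>k = 0\<close>, the same lemma for
  \<open>M C\<^sub>0 = - a\<^sub>0\<close> gives a second line of slope \<open>b - val a\<^sub>0\<close> below all points.\<close>

lemma char_poly_above_line:
  fixes a b :: real
  assumes M: "M \<in> carrier_mat n n"
    and line: "\<And>u v. (u, v) \<in> (\<Union>f\<in>elements_mat (Com M). coeff_points val f) \<Longrightarrow> b + a * u \<le> v"
    and xy: "(x, y) \<in> convex hull coeff_points val (char_poly M)" and x: "1 \<le> x"
  shows "b + a * (x - 1) \<le> y"
proof -
  let ?\<chi> = "char_poly M"
  have C_ge: "ereal (b + a * real k) \<le> val (Com_coeff M k $$ (i, j))" if ij: "i < n" "j < n" for i j k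
  proof (cases "val (coeff (Com M $$ (i, j)) k)")
    case (real r)
    have "Com M $$ (i, j) \<in> elements_mat (Com M)" using Com_carrier[OF M] ij by (intro elements_matI) auto
    hence "b + a * real k \<le> r" using real by (intro line) (auto simp: coeff_points_def)
    thus ?thesis using real by (simp add: Com_coeff_index[OF M ij])
  qed (use val_not_MInfty in \<open>auto simp: Com_coeff_index[OF M ij]\<close>)
  have above: "b' + a' * x \<le> y"
    if "\<And>k. coeff ?\<chi> k \<noteq> 0 \<Longrightarrow> ereal (b' + a' * real k) \<le> val (coeff ?\<chi> k)" for a' b'
  proof (rule convex_hull_halfplane[OF xy])
    fix u v assume "(u, v) \<in> coeff_points val ?\<chi>"
    then obtain k where "u = real k" "val (coeff ?\<chi> k) = ereal v" unfolding coeff_points_def by auto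
    thus "b' + a' * u \<le> v" using that[of k] by (auto simp: val_eq_infinity_iff[symmetric])
  qed
  define I where "I = {k. coeff ?\<chi> k \<noteq> 0}"
  \<comment> \<open>\<open>w k\<close> is the height at abscissa 0 of the line of slope
    \<open>a\<close> through the point of index \<open>k\<close>.\<close>
  define w where "w k = real_of_ereal (val (coeff ?\<chi> k)) - a * real k" for k
  have val_w: "val (coeff ?\<chi> k) = ereal (w k + a * real k)" if "k \<in> I" for k
  proof -
    have "coeff ?\<chi> k \<noteq> 0" using that unfolding I_def by simp
    then obtain r where "val (coeff ?\<chi> k) = ereal r" by (rule val_real)
    thus ?thesis by (simp add: w_def)
  qed
  have "finite I" unfolding I_def by (rule finite_subset[of _ "{..degree ?\<chi>}"]) (auto intro: le_degree)
  moreover have "n \<in> I" using degree_monic_char_poly[OF M] unfolding I_def by simp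
  ultimately obtain k where k: "k \<in> I" "\<And>j. j \<in> I \<Longrightarrow> w k \<le> w j"
    using arg_min_if_finite[of I w] by (metis empty_iff not_less)
  have ge_k: "ereal (w k + a * real j) \<le> val (coeff ?\<chi> j)" if "coeff ?\<chi> j \<noteq> 0" for j
    using k(2)[of j] val_w[of j] that unfolding I_def by simp
  show ?thesis
  proof (cases "k = 0")
    case False
    \<comment> \<open>The target line \<open>b + a (u - 1)\<close> has height \<open>b - a\<close>
      at abscissa 0, so it is enough to compare intercepts with the supporting line of slope
      \<open>a\<close>.\<close>
    have "b - a \<le> w k"
    proof (rule ccontr)
      assume lt: "\<not> b - a \<le> w k"
      obtain u where u: "val (coeff ?\<chi> 0) = ereal u"
        "\<And>j. ereal (u + real j * (b + a * real k - (w k + a * real k))) \<le> val (coeff ?\<chi> j)"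
      proof (rule coeff_char_poly_ge[OF M _ _ _ val_w[OF k(1)], of "Com_coeff M k" "Com_coeff M (k - 1)"])
        show "M * Com_coeff M k = Com_coeff M (k - 1) - coeff ?\<chi> k \<cdot>\<^sub>m 1\<^sub>m n"
          using mult_Com_coeff[OF M, of k] False by simp
        fix i j assume ij: "i < n" "j < n"
        show "ereal (b + a * real k) \<le> val (Com_coeff M k $$ (i, j))" by (rule C_ge[OF ij])
        have "ereal (w k + a * real k) < ereal (b + a * real (k - 1))"
          using lt False by (simp add: of_nat_diff algebra_simps)
        also have "\<dots> \<le> val (Com_coeff M (k - 1) $$ (i, j))" by (rule C_ge[OF ij])
        finally show "ereal (w k + a * real k) < val (Com_coeff M (k - 1) $$ (i, j))" .
      qed (use M in auto)
      \<comment> \<open>The line obtained through the point of index 0 has slope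
        \<open>b - w k\<close>, which exceeds \<open>a\<close>. Since it lies below the point of
        index \<open>k > 0\<close>, it forces \<open>w k > w 0\<close>, against minimality.\<close>
      have "0 \<in> I" using u(1) unfolding I_def by auto
      hence "w k \<le> u" using k(2)[of 0] u(1) by (simp add: w_def)
      moreover have "u + real k * (b - w k) \<le> w k + a * real k" using u(2)[of k] val_w[OF k(1)] by simp
      moreover have "real k * a < real k * (b - w k)" using lt False by (intro mult_strict_left_mono) auto
      ultimately show False by (simp add: algebra_simps)
    qed
    thus ?thesis using above[OF ge_k] by (simp add: algebra_simps)
  next
    case True
    define v where "v = w 0"
    have v: "val (coeff ?\<chi> 0) = ereal v" using val_w[OF k(1)] True by (simp add: v_def)
    obtain u where u: "val (coeff ?\<chi> 0) = ereal u"
      "\<And>j. ereal (u + real j * (b - v)) \<le> val (coeff ?\<chi> j)"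
    proof (rule coeff_char_poly_ge[OF M _ _ _ v, of "Com_coeff M 0" "0\<^sub>m n n"])
      show "M * Com_coeff M 0 = 0\<^sub>m n n - coeff ?\<chi> 0 \<cdot>\<^sub>m 1\<^sub>m n" using mult_Com_coeff[OF M, of 0] by simp
      show "ereal b \<le> val (Com_coeff M 0 $$ (i, j))" if "i < n" "j < n" for i j using C_ge[OF that, of 0] by simp
    qed (use M in auto)
    \<comment> \<open>This line and the target line both have height \<open>b\<close> at abscissa 1.
      If its slope exceeds \<open>a\<close> it dominates the target for \<open>x \<ge> 1\<close>;
      otherwise \<open>b - a \<le> v\<close> and the parallel line \<open>l2\<close> does.\<close>
    have l1: "v + (b - v) * x \<le> y" using above[of v "b - v"] u v by (simp add: mult.commute)
    have l2: "v + a * x \<le> y" using above[OF ge_k] True by (simp add: v_def)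
    show ?thesis
    proof (cases "b - v \<le> a")
      case True
      thus ?thesis using l2 by (simp add: algebra_simps)
    next
      case False
      hence "0 \<le> (b - v - a) * (x - 1)" using x by (intro mult_nonneg_nonneg) auto
      thus ?thesis using l1 by (simp add: algebra_simps)
    qed
  qed
qed

text \<open>With integral coefficients the hull stays above 0 and contains \<open>(n, 0)\<close>, so
  moving from any of its points towards \<open>(n, 0)\<close> does not raise the height.\<close>

lemma NP_shift_le:
  assumes M: "M \<in> carrier_mat n n" and int: "set (coeffs (char_poly M)) \<subseteq> integers_of val"
    and x: "x \<le> real n - 1"
  shows "NP val M (x + 1) \<le> NP val M x"
  unfolding NP_def newton_polygon_eq
proof (rule lower_convex_hull_geI)
  let ?P = "coeff_points val (char_poly M)"
  fix y assume xy: "(x, y) \<in> convex hull ?P"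
  have "0 + 0 * x \<le> y"
  proof (rule convex_hull_halfplane[OF xy])
    fix u v assume "(u, v) \<in> ?P"
    then obtain k where k: "val (coeff (char_poly M) k) = ereal v" unfolding coeff_points_def by auto
    hence "coeff (char_poly M) k \<noteq> 0" by auto
    hence "coeff (char_poly M) k \<in> set (coeffs (char_poly M))"
      using coeff_in_coeffs[of "char_poly M" k] le_degree[of "char_poly M" k] by force
    thus "0 + 0 * u \<le> v" using int k by (auto simp: integers_of_def zero_ereal_def)
  qed
  moreover have "(real n, 0) \<in> ?P"
    using degree_monic_char_poly[OF M] by (auto simp: coeff_points_def zero_ereal_def)
  \<comment> \<open>The weight that puts the convex combination of \<open>(x, y)\<close> and
    \<open>(n, 0)\<close> at abscissa \<open>x + 1\<close>.\<close>
  moreover define t where "t = 1 / (real n - x)"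
  moreover have t: "0 \<le> t" "t \<le> 1" "t * (real n - x) = 1" using x unfolding t_def by auto
  ultimately have "(1 - t) *\<^sub>R (x, y) + t *\<^sub>R (real n, 0) \<in> convex hull ?P"
    using xy by (intro convexD[OF convex_convex_hull]) (auto intro: hull_inc)
  moreover have "(1 - t) *\<^sub>R (x, y) + t *\<^sub>R (real n, 0) = (x + 1, (1 - t) * y)"
    using t(3) by (simp add: algebra_simps)
  moreover have "(1 - t) * y \<le> y" using t \<open>0 + 0 * x \<le> y\<close> by (simp add: mult_left_le_one_le)
  ultimately show "lower_convex_hull ?P (x + 1) \<le> ereal y"
    by (intro lower_convex_hull_le) (auto simp: up_closure_def)
qed

end

section \<open>Comparison with the Hodge polygon and the two endpoints\<close>

context smith_decomposed
begin

definition hodge_points :: "(real \<times> real) set" where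
  "hodge_points = {(real i, y) |i y. i \<le> n \<and> partial_sum (n - i) = ereal y}"

definition com_points :: "(real \<times> real) set" where
  "com_points = (\<Union>f\<in>elements_mat (Com M). coeff_points val f)"

lemma finite_com_points: "finite com_points"
  unfolding com_points_def by (rule finite_Union_coeff_points)

lemma PP_com_points: "PP val M = lower_convex_hull com_points"
  unfolding com_points_def by (rule PP_eq)

lemma com_pointsI:
  "i < n \<Longrightarrow> j < n \<Longrightarrow> val (coeff (Com M $$ (i, j)) k) = ereal y \<Longrightarrow> (real k, y) \<in> com_points"
  unfolding com_points_def coeff_points_def using Com_carrier[OF M] by (auto intro: elements_matI)

lemma hodge_le_PP: "lower_convex_hull hodge_points (x + 1) \<le> PP val M x"
proof -
  have "lower_convex_hull {(u - 1, v) |u v. (u, v) \<in> hodge_points} x \<le> lower_convex_hull com_points x"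
  proof (rule lower_convex_hull_mono, rule subsetI)
    fix p assume "p \<in> com_points"
    then obtain f k y where f: "f \<in> elements_mat (Com M)" and p: "p = (real k, y)" "val (coeff f k) = ereal y"
      unfolding com_points_def coeff_points_def by auto
    obtain i j where ij: "i < n" "j < n" "f = Com M $$ (i, j)"
      using elements_matD[OF f] carrier_matD[OF Com_carrier[OF M]] by auto
    have le: "(if k < n then partial_sum (n - 1 - k) else \<infinity>) \<le> ereal y"
      using coeff_Com_ge[OF ij(1,2), of k] p(2) ij(3) by simp
    hence k: "k < n" by (auto split: if_splits)
    then obtain z where z: "partial_sum (n - (k + 1)) = ereal z" "z \<le> y"
      using le by (cases "partial_sum (n - (k + 1))") (auto simp: partial_sum_eq)
    have "(real (k + 1), z) \<in> hodge_points" using k z(1) unfolding hodge_points_def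
      by (intro CollectI exI[of _ "k + 1"] exI[of _ z]) auto
    hence "(real k, z) \<in> {(u - 1, v) |u v. (u, v) \<in> hodge_points}" by force
    thus "p \<in> up_closure (convex hull {(u - 1, v) |u v. (u, v) \<in> hodge_points})"
      using z(2) p(1) by (auto simp: up_closure_def intro: hull_inc)
  qed
  thus ?thesis
    unfolding PP_com_points translate_lower_convex_hull[symmetric] by (simp add: translate_polygon_def)
qed

lemma PP_top: "PP val M (real n - 1) \<le> 0"
proof -
  have "(real (n - 1), 0) \<in> com_points"
    using n coeff_top_Com[of 0 0] by (intro com_pointsI[of 0 0]) (auto simp: zero_ereal_def[symmetric])
  thus ?thesis using lower_convex_hull_point_le[of "real n - 1" 0 com_points] n
    by (simp add: PP_com_points of_nat_diff zero_ereal_def)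
qed

lemma hodge_top: "0 \<le> lower_convex_hull hodge_points (real n)"
proof -
  \<comment> \<open>The line of slope \<open>- t\<close> through \<open>(n, 0)\<close> supports the
    Hodge points, each of which sums \<open>n - i\<close> terms of size at least \<open>t\<close>.
    If the first diagonal entry is 0, any real \<open>t\<close> serves.\<close>
  obtain t where t: "ereal t \<le> val (D $$ (0, 0))"
    using val_not_MInfty[of "D $$ (0, 0)"] by (cases "val (D $$ (0, 0))") auto
  have "ereal (real n * t + - t * real n) \<le> lower_convex_hull hodge_points (real n)"
  proof (rule lower_convex_hull_halfplane)
    fix u v assume "(u, v) \<in> hodge_points"
    then obtain i where i: "i \<le> n" "u = real i" "partial_sum (n - i) = ereal v" unfolding hodge_points_def by auto
    have "ereal (real (n - i) * t) = (\<Sum>r<n - i. ereal t)" by simp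
    also have "\<dots> \<le> partial_sum (n - i)" unfolding partial_sum_def
      by (intro sum_mono order.trans[OF t] sorted) auto
    finally show "real n * t + - t * u \<le> v" using i by (simp add: of_nat_diff algebra_simps)
  qed
  thus ?thesis by (simp add: zero_ereal_def mult.commute)
qed

text \<open>By the ordering, a zero before the last diagonal entry makes the last one zero too, and
  two zeros are excluded by the Jordan hypothesis.\<close>

lemma partial_sum_finite:
  assumes "distinct_jordan_eigenvalues M"
  obtains c where "partial_sum (n - 1) = ereal c" and "\<And>r. r < n - 1 \<Longrightarrow> D $$ (r, r) \<noteq> 0"
proof -
  obtain W where V: "V \<in> carrier_mat n n" "W \<in> carrier_mat n n" "V * W = 1\<^sub>m n"
    using uniV by (rule unimodularE)
  have U: "U \<in> carrier_mat n n" using uniU unfolding unimodular_def by auto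
  have nz: "D $$ (r, r) \<noteq> 0" if r: "r < n - 1" for r
  proof
    assume 0: "D $$ (r, r) = 0"
    hence "D $$ (n - 1, n - 1) = 0" using sorted[of r "n - 1"] r by (simp add: val_eq_infinity_iff)
    moreover have "D $$ (n - 1, n - 1) \<noteq> 0"
      using r 0 assms unfolding MUDV
      by (intro distinct_jordan_eigenvalues_diagonal[OF _ U D V, of r]) auto
    ultimately show False by simp
  qed
  hence "(\<Prod>r<n - 1. D $$ (r, r)) \<noteq> 0" by simp
  then obtain c where "partial_sum (n - 1) = ereal c" using val_real unfolding partial_sum_eq by metis
  thus thesis using nz that by blast
qed

lemma hodge_bottom:
  assumes c: "partial_sum (n - 1) = ereal c" and nz: "\<And>r. r < n - 1 \<Longrightarrow> D $$ (r, r) \<noteq> 0"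
  shows "ereal c \<le> lower_convex_hull hodge_points 1"
proof -
  \<comment> \<open>The supporting line through \<open>(1, c)\<close> has slope \<open>- t\<close>
    with \<open>t\<close> between \<open>\<sigma>\<^sub>n\<^sub>-\<^sub>1\<close> and
    \<open>\<sigma>\<^sub>n\<close>. For \<open>n \<ge> 2\<close> the finite value
    \<open>\<sigma>\<^sub>n\<^sub>-\<^sub>1\<close> is taken; for \<open>n = 1\<close> only the
    upper constraint exists.\<close>
  obtain t where t: "ereal t \<le> val (D $$ (n - 1, n - 1))" "\<And>r. r < n - 1 \<Longrightarrow> val (D $$ (r, r)) \<le> ereal t"
  proof (cases "n = 1")
    case True
    thus ?thesis using val_not_MInfty[of "D $$ (n - 1, n - 1)"] that
      by (cases "val (D $$ (n - 1, n - 1))") auto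
  next
    case False
    hence n2: "n - 2 < n - 1" using n by simp
    then obtain t where "val (D $$ (n - 2, n - 2)) = ereal t" using val_real[OF nz] by metis
    thus ?thesis using that[of t] sorted[of "n - 2" "n - 1"] sorted[of _ "n - 2"] n n2 by fastforce
  qed
  have "ereal ((c + t) + - t * 1) \<le> lower_convex_hull hodge_points 1"
  proof (rule lower_convex_hull_halfplane)
    fix u v assume "(u, v) \<in> hodge_points"
    then obtain i where i: "i \<le> n" "u = real i" "partial_sum (n - i) = ereal v" unfolding hodge_points_def by auto
    show "(c + t) + - t * u \<le> v"
    proof (cases "i = 0")
      case True
      have "{..<n} = insert (n - 1) {..<n - 1}" using n by auto
      hence "partial_sum n = val (D $$ (n - 1, n - 1)) + ereal c"
        unfolding partial_sum_def c[unfolded partial_sum_def, symmetric] by simp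
      hence "ereal t + ereal c \<le> ereal v" using i True t(1) by (metis add_right_mono diff_zero)
      thus ?thesis using i True by simp
    next
      case False
      have split: "{..<n - 1} = {..<n - i} \<union> {n - i..<n - 1}" using False n by auto
      have "ereal c = partial_sum (n - i) + (\<Sum>r = n - i..<n - 1. val (D $$ (r, r)))"
        unfolding c[symmetric] partial_sum_def split by (rule sum.union_disjoint) auto
      also have "\<dots> \<le> ereal v + (\<Sum>r = n - i..<n - 1. ereal t)"
        unfolding i(3) by (intro add_left_mono sum_mono t(2)) auto
      finally have "c \<le> v + (real (n - 1) - real (n - i)) * t" using False i(1) by (simp add: of_nat_diff)
      thus ?thesis using i False n by (simp add: of_nat_diff algebra_simps)
    qed
  qed
  thus ?thesis by simp
qed

lemma PP_bottom: "PP val M 0 \<le> partial_sum (n - 1)"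
proof -
  obtain i j where ij: "i < n" "j < n" and le: "val (coeff (Com M $$ (i, j)) 0) \<le> partial_sum (n - 1)"
    by (rule coeff_0_Com_attained)
  show ?thesis
  proof (cases "val (coeff (Com M $$ (i, j)) 0)")
    case (real y)
    have "(real 0, y) \<in> com_points" using real by (intro com_pointsI[OF ij])
    hence "PP val M 0 \<le> ereal y" unfolding PP_com_points by (intro lower_convex_hull_point_le) simp
    thus ?thesis using le real by simp
  qed (use le val_not_MInfty in auto)
qed

text \<open>Every line below the comatrix points, shifted by one, stays below the characteristic
  polynomial. Finiteness of \<open>c\<close> provides a comatrix point at abscissa 0, so that the
  hull covers the whole interval.\<close>

lemma PP_le_NP:
  assumes c: "partial_sum (n - 1) = ereal c" and x: "0 \<le> x" "x \<le> real n - 1"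
  shows "PP val M x \<le> NP val M (x + 1)"
  unfolding NP_def newton_polygon_eq
proof (rule lower_convex_hull_geI)
  fix y assume xy: "(x + 1, y) \<in> convex hull coeff_points val (char_poly M)"
  obtain i j where ij: "i < n" "j < n" and le: "val (coeff (Com M $$ (i, j)) 0) \<le> ereal c"
    using coeff_0_Com_attained c by metis
  obtain y0 where "val (coeff (Com M $$ (i, j)) 0) = ereal y0"
    using le val_not_MInfty by (cases "val (coeff (Com M $$ (i, j)) 0)") auto
  hence left: "(0, y0) \<in> com_points" using com_pointsI[OF ij, of 0] by simp
  have "(real (n - 1), 0) \<in> com_points"
    using n coeff_top_Com[of 0 0] by (intro com_pointsI[of 0 0]) (auto simp: zero_ereal_def[symmetric])
  then obtain y1 where cover: "(x, y1) \<in> convex hull com_points"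
    using convex_hull_segment_covers[OF left, of "real (n - 1)" 0 x] x n by (auto simp: of_nat_diff)
  show "PP val M x \<le> ereal y"
    unfolding PP_com_points
  proof (rule lower_convex_hull_leI[OF finite_com_points cover])
    fix a b assume line: "\<And>u v. (u, v) \<in> com_points \<Longrightarrow> b + a * u \<le> v"
    have "b + a * (x + 1 - 1) \<le> y"
      by (rule char_poly_above_line[OF M _ xy]) (use line x in \<open>auto simp: com_points_def\<close>)
    thus "b + a * x \<le> y" by simp
  qed
qed

end

text \<open>The Newton bound without translation is stated for integral characteristic polynomials:
  for \<open>n = 1\<close> and an entry \<open>m\<close> with \<open>val m < 0\<close>, the
  precision polygon has height 0 at abscissa 0 while the Newton polygon has height
  \<open>val m\<close> there.\<close>

theorem proposition3p4:
  fixes val :: "'a :: field \<Rightarrow> ereal" and M :: "'a mat" and n :: nat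
  assumes "complete_dvf val"
    and "0 < n" and "M \<in> carrier_mat n n"
    and "distinct_jordan_eigenvalues M"
  shows "(\<forall>x \<in> {0..real n - 1}.
            translate_polygon 1 (HP val M) x \<le> PP val M x \<and>
            PP val M x \<le> translate_polygon 1 (NP val M) x \<and>
            (set (coeffs (char_poly M)) \<subseteq> integers_of val \<longrightarrow> PP val M x \<le> NP val M x)) \<and>
         meet_at (PP val M) (translate_polygon 1 (HP val M)) 0 \<and>
         meet_at (PP val M) (translate_polygon 1 (HP val M)) (real n - 1)"
proof -
  interpret dvf: complete_dvf val by (rule assms(1))
  have "\<exists>U V. smith_decomposition val M U (smith_diagonal val M) V"
    unfolding smith_diagonal_def
    using dvf.smith_decomposition_exists[OF assms(3)] by (rule_tac someI_ex) blast
  then obtain U V where smith: "smith_decomposition val M U (smith_diagonal val M) V" by blast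
  interpret smith_decomposed val M U "smith_diagonal val M" V n
    by unfold_locales (rule assms smith)+
  have sigma: "(\<Sum>j = 1..m. sigma val M j) = partial_sum m" for m
    unfolding partial_sum_def sigma_def by (induction m) (simp_all add: add.commute)
  have HP: "HP val M = lower_convex_hull hodge_points"
    using assms(3) unfolding HP_def Let_def sigma hodge_points_def by simp
  obtain c where c: "partial_sum (n - 1) = ereal c"
    and nz: "\<And>r. r < n - 1 \<Longrightarrow> smith_diagonal val M $$ (r, r) \<noteq> 0"
    using partial_sum_finite[OF assms(4)] by blast
  have HP_le: "translate_polygon 1 (HP val M) x \<le> PP val M x" for x
    using hodge_le_PP[of x] by (simp add: translate_polygon_def HP)
  have le_NP: "PP val M x \<le> NP val M (x + 1)" if "x \<in> {0..real n - 1}" for x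
    using PP_le_NP[OF c] that by simp
  have "PP val M x \<le> NP val M x"
    if "x \<in> {0..real n - 1}" "set (coeffs (char_poly M)) \<subseteq> integers_of val" for x
    using le_NP[OF that(1)] dvf.NP_shift_le[OF assms(3) that(2), of x] that(1) by auto
  moreover have "meet_at (PP val M) (translate_polygon 1 (HP val M)) 0"
  proof -
    \<comment> \<open>The translated Hodge polygon is squeezed between \<open>c\<close> and the
      precision polygon, which is itself at most \<open>c\<close> here, so all three agree.\<close>
    have "ereal c \<le> translate_polygon 1 (HP val M) 0"
      using hodge_bottom[OF c nz] by (simp add: translate_polygon_def HP)
    moreover have "PP val M 0 \<le> ereal c" using PP_bottom c by simp
    ultimately show ?thesis using HP_le[of 0] unfolding meet_at_def by (intro exI[of _ c]) auto
  qed
  moreover have "meet_at (PP val M) (translate_polygon 1 (HP val M)) (real n - 1)"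
  proof -
    have "0 \<le> translate_polygon 1 (HP val M) (real n - 1)"
      using hodge_top by (simp add: translate_polygon_def HP)
    thus ?thesis using HP_le[of "real n - 1"] PP_top unfolding meet_at_def
      by (intro exI[of _ 0]) (auto simp: zero_ereal_def[symmetric])
  qed
  ultimately show ?thesis using HP_le le_NP by (auto simp: translate_polygon_def)
qed

end
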